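(* Let $0\le\beta<1$ and let $\mathbf{H}$ be the Hilbert matrix. Then, as $N\to\infty$, $$\log\det\big(I_N-\beta^2\,1_N\mathbf{H}^2 1_N\big) = -\frac{1}{\pi^2}\arcsin^2(\beta)\,\log N+o(\log N).$$
   Context: $\mathbb{Z}_+=\{0,1,2,\dots\}$. The Hilbert matrix $\mathbf{H}$ is the bounded operator on $\ell^2(\mathbb{Z}_+)$ with matrix elements $\mathbf{H}(n,m)=\frac{1}{\pi(n+m+1)}$, $n,m\in\mathbb{Z}_+$. $1_N$ is the orthogonal projection in $\ell^2(\mathbb{Z}_+)$ onto the span of the standard basis vectors $e_0,\dots,e_{N-1}$; $1_N\mathbf{H}^21_N$ is regarded as an $N\times N$ matrix and $I_N$ is the $N\times N$ identity matrix. $\arcsin^2(\beta)=(\arcsin\beta)^2$. *)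

theory Defs
  imports "HOL-Analysis.Analysis" "HOL-Library.Landau_Symbols" "Jordan_Normal_Form.Determinant"
begin

definition ell2 :: "(nat \<Rightarrow> real) set" where
  "ell2 = {f. summable (\<lambda>n. (f n)\<^sup>2)}"

definition ell2_basis :: "nat \<Rightarrow> nat \<Rightarrow> real" where
  "ell2_basis m = (\<lambda>n. if n = m then 1 else 0)"

definition hilbert_matrix :: "nat \<Rightarrow> nat \<Rightarrow> real" where
  "hilbert_matrix n m = 1 / (pi * (real n + real m + 1))"

text \<open>
  The operator on sequences given by the Hilbert matrix. The series is only meaningful where it
  converges; \<open>hilbert_op_summable\<close> shows that this is so on all of \<open>ell2\<close>.
  Operators are plain functions on real sequences, so composition is the operator product. The
  matrix elements being real, real scalars lose nothing.
\<close>

definition hilbert_op :: "(nat \<Rightarrow> real) \<Rightarrow> (nat \<Rightarrow> real)" where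
  "hilbert_op f = (\<lambda>n. \<Sum>m. hilbert_matrix n m * f m)"

text \<open>The orthogonal projection onto the span of \<open>ell2_basis 0, \<dots>, ell2_basis (N - 1)\<close>.\<close>

definition ell2_proj :: "nat \<Rightarrow> (nat \<Rightarrow> real) \<Rightarrow> (nat \<Rightarrow> real)" where
  "ell2_proj N f = (\<lambda>n. if n < N then f n else 0)"

text \<open>
  For \<open>T = ell2_proj N \<circ> S \<circ> ell2_proj N\<close> this is \<open>T\<close> regarded as an \<open>N\<close> by \<open>N\<close> matrix: the entry
  at \<open>(n, m)\<close> is the \<open>n\<close>-th coordinate of the image of the \<open>m\<close>-th basis vector.
\<close>

definition finite_section :: "nat \<Rightarrow> ((nat \<Rightarrow> real) \<Rightarrow> (nat \<Rightarrow> real)) \<Rightarrow> real mat" where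
  "finite_section N T = mat N N (\<lambda>(n, m). T (ell2_basis m) n)"

lemma hilbert_row_ell2: "hilbert_matrix n \<in> ell2"
proof -
  have "summable (\<lambda>m. (hilbert_matrix n m)\<^sup>2)"
  proof (rule summable_comparison_test)
    show "summable (\<lambda>m. inverse (real (Suc m) ^ 2))"
      using inverse_power_summable[of 2, where 'a = real] by (subst summable_Suc_iff) simp
    have "hilbert_matrix n m \<le> inverse (real (Suc m))" "0 \<le> hilbert_matrix n m" for m
    proof -
      have "1 * real (Suc m) \<le> pi * (real n + real m + 1)"
        using pi_gt3 by (intro mult_mono) auto
      then show "hilbert_matrix n m \<le> inverse (real (Suc m))"
        unfolding hilbert_matrix_def inverse_eq_divide by (intro divide_left_mono) auto
      show "0 \<le> hilbert_matrix n m"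
        by (simp add: hilbert_matrix_def)
    qed
    then have "norm ((hilbert_matrix n m)\<^sup>2) \<le> inverse (real (Suc m) ^ 2)" for m
      by (simp add: power_mono flip: power_inverse)
    then show "\<exists>M. \<forall>m\<ge>M. norm ((hilbert_matrix n m)\<^sup>2) \<le> inverse (real (Suc m) ^ 2)"
      by blast
  qed
  then show ?thesis by (simp add: ell2_def)
qed

lemma hilbert_op_summable:
  assumes "f \<in> ell2"
  shows "summable (\<lambda>m. hilbert_matrix n m * f m)"
proof (rule summable_comparison_test)
  show "summable (\<lambda>m. (hilbert_matrix n m)\<^sup>2 + (f m)\<^sup>2)"
    using assms hilbert_row_ell2[of n] by (intro summable_add) (simp_all add: ell2_def)
  have "\<bar>x * y\<bar> \<le> x\<^sup>2 + y\<^sup>2" for x y :: real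
  proof -
    have "2 * (\<bar>x\<bar> * \<bar>y\<bar>) \<le> x\<^sup>2 + y\<^sup>2"
      using sum_squares_bound[of "\<bar>x\<bar>" "\<bar>y\<bar>"] by simp
    moreover have "0 \<le> \<bar>x\<bar> * \<bar>y\<bar>" by simp
    ultimately show ?thesis unfolding abs_mult by linarith
  qed
  then show "\<exists>M. \<forall>m\<ge>M. norm (hilbert_matrix n m * f m) \<le> (hilbert_matrix n m)\<^sup>2 + (f m)\<^sup>2"
    by simp
qed

lemma hilbert_op_basis: "hilbert_op (ell2_basis m) = (\<lambda>n. hilbert_matrix n m)"
proof
  fix n
  have "(\<lambda>k. hilbert_matrix n k * ell2_basis m k) = (\<lambda>k. if k = m then hilbert_matrix n k else 0)"
    by (auto simp: ell2_basis_def)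
  then show "hilbert_op (ell2_basis m) n = hilbert_matrix n m"
    using sums_single[of m "hilbert_matrix n"] by (simp add: hilbert_op_def sums_iff)
qed

lemma hilbert_section_entry:
  assumes "n < N" "m < N"
  shows "finite_section N (ell2_proj N \<circ> hilbert_op \<circ> hilbert_op \<circ> ell2_proj N) $$ (n, m)
       = (\<Sum>k. hilbert_matrix n k * hilbert_matrix k m)"
proof -
  have "ell2_proj N (ell2_basis m) = ell2_basis m"
    using assms by (auto simp: ell2_proj_def ell2_basis_def)
  then have "finite_section N (ell2_proj N \<circ> hilbert_op \<circ> hilbert_op \<circ> ell2_proj N) $$ (n, m)
      = hilbert_op (hilbert_op (ell2_basis m)) n"
    using assms by (simp add: finite_section_def ell2_proj_def)
  then show ?thesis
    by (simp add: hilbert_op_basis) (simp add: hilbert_op_def)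
qed

end

theory Submission
  imports Defs "HOL-Real_Asymp.Real_Asymp" "Jordan_Normal_Form.Schur_Decomposition"
begin

text \<open>
  Write \<open>A\<close> for the \<open>N\<close> by \<open>N\<close> section of the squared Hilbert matrix. The determinant is reached
  through traces: \<open>ln (det (1 - z A))\<close> is minus the sum of \<open>z^k / k * trace (A^k)\<close>
  (\<open>ln_det_series\<close>), provided the eigenvalues of \<open>A\<close> lie in the closed unit disc. They do, because
  the Hilbert matrix maps the positive sequence \<open>(n + 1/2)^(-1/2)\<close> to a sequence that is nowhere
  larger (\<open>hilbert_matrix_weight_sum\<close>). Together with \<open>hilbert_matrix_le_weight\<close> this also bounds
  \<open>trace (A^k)\<close> by a multiple of \<open>ln N\<close> uniformly in \<open>k\<close>, so by Tannery's theorem only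
  the limit of \<open>trace (A^k) / ln N\<close> for each fixed \<open>k\<close> is needed.

  With nodes \<open>x_n = n + 1/2\<close> the entries \<open>1 / (pi * (x_n + x_m))\<close> are samples of the Carleman kernel
  \<open>1 / (pi * (x + y))\<close>, which is homogeneous of degree \<open>-1\<close>. In the variable \<open>t = ln x\<close> it is the
  convolution with \<open>1 / (2 pi cosh (t/2))\<close>, whose Fourier transform is \<open>1 / cosh (pi \<xi>)\<close>
  (\<open>sech_fourier\<close>). Its iterates are therefore explicit Fourier integrals of powers of the
  hyperbolic secant; sampled at the nodes they form \<open>hilbert_kernel p\<close>, and for \<open>p = 1\<close> the sample is
  the Hilbert matrix itself. One more multiplication by the Hilbert matrix leads from
  \<open>hilbert_kernel p\<close> to \<open>hilbert_kernel (p + 1)\<close> up to two errors: a sum over the nodes replaces an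
  integral (\<open>hilbert_kernel_step\<close>), and the sum may be cut off at \<open>N\<close> (\<open>hilbert_kernel_tail\<close>). Both
  errors have a form that is stable under further multiplications (\<open>approximation_step\<close>), and on the
  diagonal they add up to \<open>O(1)\<close>. As the diagonal of \<open>hilbert_kernel (2 k)\<close> is a constant multiple
  of \<open>1 / x_n\<close>, the trace of \<open>A^k\<close> is \<open>c_k ln N + O(1)\<close>, where \<open>c_k\<close> is the integral of
  \<open>cosh (pi \<xi>)^(-2k)\<close> divided by \<open>2 pi\<close>.

  Integration by parts gives \<open>c_(k+1) = 2k / (2k + 1) * c_k\<close>, which is the recurrence behind the Taylor
  series of the squared arcsine (\<open>arcsin_squared_series\<close>); this produces the constant in front of
  \<open>ln N\<close>.
\<close>

section \<open>The Fourier transform of the hyperbolic secant\<close>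

text \<open>
  The fundamental theorem of calculus on the whole line. For a nonnegative derivative the existence of
  the two limits already forces integrability, so this lemma also serves to establish integrability.
\<close>

lemma integral_on_line_of_nonneg_derivative:
  fixes f F :: "real \<Rightarrow> real"
  assumes F: "\<And>x. (F has_real_derivative f x) (at x)"
    and f: "\<And>x. isCont f x" and nonneg: "\<And>x. 0 \<le> f x"
    and A: "(F \<longlongrightarrow> A) at_bot" and B: "(F \<longlongrightarrow> B) at_top"
  shows "integrable lborel f" "integral\<^sup>L lborel f = B - A"
proof -
  have 1: "((F \<circ> real_of_ereal) \<longlongrightarrow> A) (at_right (-\<infinity>))"
    and 2: "((F \<circ> real_of_ereal) \<longlongrightarrow> B) (at_left \<infinity>)"
    using A B by (simp_all add: ereal_tendsto_simps)
  note FTC = interval_integral_FTC_nonneg[of "-\<infinity>" \<infinity> F f A B, OF _ F f _ 1 2]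
  show "integrable lborel f"
    using FTC(1) nonneg by (simp add: set_integrable_def)
  show "integral\<^sup>L lborel f = B - A"
    using FTC(2) nonneg by (simp add: interval_integral_to_infinity_eq interval_lebesgue_integral_def set_lebesgue_integral_def)
qed

text \<open>
  Euler's integral after the substitution \<open>t = exp u\<close>. On the whole line, products of two such
  integrals can be rearranged with translations alone.
\<close>

lemma Gamma_integral_on_line:
  assumes z: "Re z > 0"
  shows "integrable lborel (\<lambda>u. exp (z * of_real u - of_real (exp u)))"
    and "(LINT u|lborel. exp (z * of_real u - of_real (exp u))) = Gamma z"
proof -
  let ?f = "\<lambda>t. complex_of_real t powr (z - 1) / of_real (exp t)"
  let ?g = "\<lambda>u. exp (z * of_real u - of_real (exp u))"
  have "range exp = {0::real<..}"
    by (auto simp: image_iff) (metis exp_ln)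
  moreover have "?f absolutely_integrable_on {0<..} \<and> integral {0<..} ?f = Gamma z"
    using absolutely_integrable_Gamma_integral'[OF z] Gamma_integral_complex'[OF z]
    by (auto intro: integral_unique)
  ultimately have "(\<lambda>u. \<bar>exp u\<bar> *\<^sub>R ?f (exp u)) absolutely_integrable_on UNIV
      \<and> integral UNIV (\<lambda>u. \<bar>exp u\<bar> *\<^sub>R ?f (exp u)) = Gamma z"
    using has_absolute_integral_change_of_variables_real[of UNIV exp exp ?f "Gamma z"]
    by (auto intro!: derivative_eq_intros simp: inj_on_def)
  moreover have "(\<lambda>u. \<bar>exp u\<bar> *\<^sub>R ?f (exp u)) = ?g"
  proof
    fix u :: real
    have "complex_of_real (exp u) powr (z - 1) = exp ((z - 1) * of_real u)"
      by (simp add: powr_def Ln_of_real)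
    then show "\<bar>exp u\<bar> *\<^sub>R ?f (exp u) = ?g u"
      by (simp add: scaleR_conv_of_real exp_of_real exp_diff exp_add algebra_simps flip: exp_of_real)
  qed
  ultimately have *: "?g absolutely_integrable_on UNIV" "integral UNIV ?g = Gamma z"
    by simp_all
  have [measurable]: "?g \<in> borel_measurable borel"
    by (intro borel_measurable_continuous_onI continuous_intros)
  show int: "integrable lborel ?g"
    using *(1) by (simp add: set_integrable_def integrable_completion)
  show "integral\<^sup>L lborel ?g = Gamma z"
    using *(2) integral_lborel[OF int] by simp
qed


lemma sech_half_eq: "1 / (2 * cosh (w / 2)) = exp (w / 2) / (1 + exp w)" for w :: real
proof -
  define a where "a = exp (w / 2)"
  have a: "a > 0" "exp w = a * a" "exp (- (w / 2)) = 1 / a"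
    by (simp_all add: a_def exp_minus inverse_eq_divide flip: exp_add)
  have "a + 1 / a = (1 + a * a) / a"
    using a by (simp add: field_simps)
  moreover have "2 * cosh (w / 2) = a + 1 / a"
    by (simp add: cosh_def a flip: a_def)
  ultimately show ?thesis
    using a by (simp add: a_def[symmetric])
qed

lemma sech_integral:
  shows "integrable lborel (\<lambda>w::real. 1 / (2 * cosh (w / 2)))"
proof (rule integral_on_line_of_nonneg_derivative(1))
  show "((\<lambda>w. 2 * arctan (exp (w / 2))) has_real_derivative 1 / (2 * cosh (x / 2))) (at x)" for x :: real
  proof -
    have e: "2 * (inverse a * (b * (1 / 2))) = b / a" for a b :: real
      by (simp add: inverse_eq_divide)
    have "exp (x / 2) ^ 2 = exp x"
      by (simp add: power2_eq_square flip: exp_add)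
    moreover have "((\<lambda>w. 2 * arctan (exp (w / 2))) has_real_derivative
        2 * (inverse (1 + exp (x / 2) ^ 2) * (exp (x / 2) * (1 / 2)))) (at x)"
      by (auto intro!: derivative_eq_intros)
    ultimately show ?thesis
      unfolding sech_half_eq by (simp only: e)
  qed
  show "((\<lambda>w::real. 2 * arctan (exp (w / 2))) \<longlongrightarrow> 0) at_bot"
    by real_asymp
  show "((\<lambda>w::real. 2 * arctan (exp (w / 2))) \<longlongrightarrow> pi) at_top"
    by real_asymp
qed (auto intro!: continuous_intros)

lemma exp_gamma_integral:
  fixes c :: real assumes "c > 0"
  shows "integrable lborel (\<lambda>v. exp (v - c * exp v))" "(LINT v|lborel. exp (v - c * exp v)) = 1 / c"
proof -
  have "((\<lambda>v. - exp (- c * exp v) / c) has_real_derivative exp (x - c * exp x)) (at x)" for x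
    using assms by (auto intro!: derivative_eq_intros simp: exp_diff exp_minus field_simps)
  moreover have "((\<lambda>v. - exp (- c * exp v) / c) \<longlongrightarrow> - 1 / c) at_bot"
    using assms by (real_asymp simp: field_simps)
  moreover have "((\<lambda>v. - exp (- c * exp v) / c) \<longlongrightarrow> 0) at_top"
    using assms by real_asymp
  ultimately show "integrable lborel (\<lambda>v. exp (v - c * exp v))" "(LINT v|lborel. exp (v - c * exp v)) = 1 / c"
    using integral_on_line_of_nonneg_derivative[of "\<lambda>v. - exp (- c * exp v) / c" "\<lambda>v. exp (v - c * exp v)" "-1/c" 0]
    by (simp_all add: inverse_eq_divide)
qed

text \<open>
  Put \<open>z = 1/2 + \<i> x\<close>. The product \<open>Gamma z * Gamma (1 - z)\<close> is a double integral over the plane.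
  Translating one variable by the other and integrating the latter out with \<open>exp_gamma_integral\<close> leaves exactly the Fourier integral of the hyperbolic secant, while the
  reflection formula evaluates the product as \<open>pi / sin (pi z) = pi / cosh (pi x)\<close>.
\<close>

lemma sech_fourier_complex:
  fixes x :: real
  shows "(LINT w|lborel. exp (\<i> * of_real (x * w)) / of_real (2 * cosh (w / 2))) = of_real (pi / cosh (pi * x))"
proof -
  define z where "z = 1/2 + \<i> * of_real x"
  have z: "Re z = 1/2" "Re (1 - z) = 1/2" by (simp_all add: z_def)
  let ?\<gamma> = "\<lambda>z u. exp (z * of_real u - of_real (exp u)) :: complex"
  let ?h = "\<lambda>w v. exp (z * of_real w) * of_real (exp (v - (1 + exp w) * exp v)) :: complex"
  have e: "exp (w / 2) / (1 + exp w) = 1 / (2 * cosh (w / 2))" for w :: real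
    by (simp add: sech_half_eq)
  \<comment> \<open>The substitution \<open>u = v + w\<close> in the double integral of \<open>Gamma z * Gamma (1 -
    z)\<close>.\<close>
  have prod: "?\<gamma> z (v + 1 * w) * ?\<gamma> (1 - z) v = ?h w v" for v w
    unfolding exp_of_real[symmetric] exp_add[symmetric]
    by (simp add: exp_add algebra_simps flip: exp_of_real)
  have [measurable]: "(\<lambda>(w, v). ?h w v) \<in> borel_measurable (lborel \<Otimes>\<^sub>M lborel)"
    by measurable
  have inner: "integrable lborel (\<lambda>v. ?h w v)" 
     "(LINT v|lborel. ?h w v) = exp (\<i> * of_real (x * w)) / of_real (2 * cosh (w / 2))"
     "(LINT v|lborel. norm (?h w v)) = 1 / (2 * cosh (w / 2))" for w
  proof -
    have p: "1 + exp w > 0" by (simp add: add_pos_pos)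
    note E = exp_gamma_integral[OF p]
    show "integrable lborel (\<lambda>v. ?h w v)"
      using E(1) by (intro integrable_mult_right integrable_of_real) auto
    have "(LINT v|lborel. ?h w v) = exp (z * of_real w) * of_real (1 / (1 + exp w))"
      using E by (simp only: integral_mult_right_zero integral_complex_of_real)
    also have "\<dots> = exp (\<i> * of_real (x * w)) * of_real (exp (w / 2) / (1 + exp w))"
      by (simp add: z_def algebra_simps exp_add exp_of_real[symmetric])
    finally show "(LINT v|lborel. ?h w v) = exp (\<i> * of_real (x * w)) / of_real (2 * cosh (w / 2))"
      unfolding e by simp
    have "(LINT v|lborel. norm (?h w v)) = exp (w / 2) * (1 / (1 + exp w))"
      using E by (simp add: norm_mult z)
    then show "(LINT v|lborel. norm (?h w v)) = 1 / (2 * cosh (w / 2))"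
      using e[of w] by simp
  qed
  have int: "integrable (lborel \<Otimes>\<^sub>M lborel) (\<lambda>(w, v). ?h w v)"
    by (rule lborel_pair.Fubini_integrable) (use inner sech_integral in auto)
  have "Gamma z * Gamma (1 - z) = (LINT v|lborel. Gamma z * ?\<gamma> (1 - z) v)"
    using Gamma_integral_on_line[of "1 - z"] z by simp
  also have "\<dots> = (LINT v|lborel. (LINT w|lborel. ?h w v))"
  proof (rule Bochner_Integration.integral_cong[OF refl])
    fix v :: real
    have "Gamma z = (LINT w|lborel. ?\<gamma> z (v + 1 * w))"
      using Gamma_integral_on_line(2)[of z] z lborel_integral_real_affine[of 1 "?\<gamma> z" v] by simp
    then show "Gamma z * ?\<gamma> (1 - z) v = (LINT w|lborel. ?h w v)"
      by (simp only: prod[symmetric] integral_mult_left_zero)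
  qed
  also have "\<dots> = (LINT w|lborel. (LINT v|lborel. ?h w v))"
    using lborel_pair.Fubini_integral[OF int] by simp
  finally have "(LINT w|lborel. exp (\<i> * of_real (x * w)) / of_real (2 * cosh (w / 2))) = Gamma z * Gamma (1 - z)"
    unfolding inner by simp
  also have "\<dots> = of_real pi / sin (of_real pi * z)"
    by (rule Gamma_reflection_complex)
  also have "sin (of_real pi * z) = of_real (cosh (pi * x))"
  proof -
    have "sin (of_real pi * z) = cos (\<i> * of_real (pi * x))"
      by (simp add: z_def algebra_simps sin_add flip: sin_of_real cos_of_real)
    then show ?thesis 
      by (simp add: cosh_conv_cos[symmetric] cosh_def scaleR_conv_of_real flip: exp_of_real)
  qed
  finally show ?thesis by simp
qed

lemma sech_fourier:
  fixes x :: real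
  shows "(LINT w|lborel. cos (x * w) / cosh (w / 2)) = 2 * pi / cosh (pi * x)"
    and "(LINT w|lborel. sin (x * w) / cosh (w / 2)) = 0"
proof -
  let ?f = "\<lambda>w. exp (\<i> * of_real (x * w)) / of_real (2 * cosh (w / 2)) :: complex"
  have [measurable]: "?f \<in> borel_measurable borel"
    unfolding cosh_def by measurable
  have int: "integrable lborel ?f"
  proof (rule Bochner_Integration.integrable_bound[OF sech_integral])
    show "?f \<in> borel_measurable lborel" by measurable
  qed (simp add: norm_divide norm_mult)
  have "(LINT w|lborel. 1 / 2 * (cos (x * w) / cosh (w / 2))) = (LINT w|lborel. Re (?f w))"
    by (rule Bochner_Integration.integral_cong[OF refl])
       (simp add: Re_exp Re_divide_of_real del: of_real_mult)
  also have "\<dots> = pi / cosh (pi * x)"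
    using integral_Re[OF int] sech_fourier_complex[of x] by (simp only: Re_complex_of_real)
  finally show "(LINT w|lborel. cos (x * w) / cosh (w / 2)) = 2 * pi / cosh (pi * x)"
    by (subst (asm) integral_mult_right_zero) simp
  have "(LINT w|lborel. 1 / 2 * (sin (x * w) / cosh (w / 2))) = (LINT w|lborel. Im (?f w))"
    by (rule Bochner_Integration.integral_cong[OF refl])
       (simp add: Im_exp Im_divide_of_real del: of_real_mult)
  also have "\<dots> = 0"
    using integral_Im[OF int] sech_fourier_complex[of x] by (simp only: Im_complex_of_real)
  finally show "(LINT w|lborel. sin (x * w) / cosh (w / 2)) = 0"
    by (subst (asm) integral_mult_right_zero) simp
qed

section \<open>Fourier transforms of powers of the hyperbolic secant\<close>

lemma borel_measurable_cosh [measurable (raw)]: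
  fixes f :: "'a \<Rightarrow> real"
  assumes "f \<in> borel_measurable M" shows "(\<lambda>x. cosh (f x)) \<in> borel_measurable M"
  unfolding cosh_def using assms by measurable

lemma integrable_sech: 
  assumes "(a::real) > 0" shows "integrable lborel (\<lambda>x. 1 / cosh (a * x))"
proof -
  have "integrable lborel (\<lambda>x. 1 / (2 * cosh ((0 + (2 * a) * x) / 2)))"
    using assms by (intro lborel_integrable_real_affine sech_integral) auto
  then have "integrable lborel (\<lambda>x. 2 * (1 / (2 * cosh ((0 + (2 * a) * x) / 2))))"
    by (intro integrable_mult_right)
  then show ?thesis by simp
qed

lemma sech_le_exp: "1 / cosh x \<le> 2 * exp (- \<bar>x\<bar>)" for x :: real
proof -
  have "exp \<bar>x\<bar> \<le> 2 * cosh x"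
    by (cases "x \<ge> 0") (simp_all add: cosh_def)
  then show ?thesis
    by (simp add: exp_minus field_simps)
qed

lemma exp_le_sech: "exp (- \<bar>x\<bar>) \<le> 1 / cosh x" for x :: real
proof -
  have "exp (- \<bar>x\<bar>) \<le> exp \<bar>x\<bar>" by simp
  then have "2 * cosh x \<le> 2 * exp \<bar>x\<bar>"
    by (cases "x \<ge> 0") (simp_all add: cosh_def)
  then show ?thesis
    by (simp add: exp_minus field_simps)
qed

lemma integrable_exp_neg_abs:
  assumes "(a::real) > 0" shows "integrable lborel (\<lambda>x. exp (- (a * \<bar>x\<bar>)))"
proof (rule Bochner_Integration.integrable_bound[OF integrable_sech[OF assms]])
  show "AE x in lborel. norm (exp (- (a * \<bar>x\<bar>))) \<le> norm (1 / cosh (a * x))"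
    using exp_le_sech[of "a * x" for x] assms by (intro AE_I2) (simp add: abs_mult)
qed auto

text \<open>
  The factor \<open>\<bar>x\<bar>\<close> in the second bound is what a derivative in the Fourier variable costs.
\<close>

lemma sech_power_bounds:
  fixes x :: real
  assumes "p \<ge> 1"
  shows "(1 / cosh (pi * x)) ^ p \<le> 2 * exp (- (1 * \<bar>x\<bar>))"
    and "\<bar>x\<bar> * (1 / cosh (pi * x)) ^ p \<le> 2 * exp (- (1 * \<bar>x\<bar>))"
proof -
  have "(1 / cosh (pi * x)) ^ p \<le> (1 / cosh (pi * x)) ^ 1"
    using assms by (intro power_decreasing) (auto simp: cosh_real_ge_1)
  also have "\<dots> \<le> 2 * exp (- (pi * \<bar>x\<bar>))"
    using sech_le_exp[of "pi * x"] by (simp add: abs_mult)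
  also have "\<dots> \<le> 2 * exp (- (2 * \<bar>x\<bar>))"
    using pi_ge_two by (simp add: mult_right_mono)
  finally have *: "(1 / cosh (pi * x)) ^ p \<le> 2 * exp (- (2 * \<bar>x\<bar>))" .
  also have "\<dots> \<le> 2 * exp (- (1 * \<bar>x\<bar>))" by simp
  finally show "(1 / cosh (pi * x)) ^ p \<le> 2 * exp (- (1 * \<bar>x\<bar>))" .
  have "\<bar>x\<bar> * (1 / cosh (pi * x)) ^ p \<le> exp \<bar>x\<bar> * (2 * exp (- (2 * \<bar>x\<bar>)))"
    using * exp_ge_add_one_self[of "\<bar>x\<bar>"] by (intro mult_mono) (auto intro: order.trans[OF _ exp_ge_add_one_self])
  also have "\<dots> = 2 * exp (- (1 * \<bar>x\<bar>))"
    by (simp flip: exp_add)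
  finally show "\<bar>x\<bar> * (1 / cosh (pi * x)) ^ p \<le> 2 * exp (- (1 * \<bar>x\<bar>))" .
qed

lemma integrable_sech_power:
  assumes "p \<ge> 1"
  shows "integrable lborel (\<lambda>x::real. (1 / cosh (pi * x)) ^ p)"
    and "integrable lborel (\<lambda>x::real. \<bar>x\<bar> * (1 / cosh (pi * x)) ^ p)"
proof -
  have "integrable lborel (\<lambda>x::real. 2 * exp (- (1 * \<bar>x\<bar>)))"
    by (intro integrable_mult_right integrable_exp_neg_abs) auto
  then show "integrable lborel (\<lambda>x::real. (1 / cosh (pi * x)) ^ p)"
    and "integrable lborel (\<lambda>x::real. \<bar>x\<bar> * (1 / cosh (pi * x)) ^ p)"
    by (rule Bochner_Integration.integrable_bound, measurable,
        use sech_power_bounds[OF assms] in \<open>simp add: abs_mult power_abs\<close>)+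
qed

text \<open>
  The Fourier transform of the \<open>p\<close>-th power of the hyperbolic secant. Up to the normalisation of
  \<open>sech_transform_1\<close> and \<open>sech_transform_Suc\<close> it is the \<open>p\<close>-fold convolution power of
  \<open>1 / cosh (t / 2)\<close>.
\<close>

definition sech_transform :: "nat \<Rightarrow> real \<Rightarrow> real" where
  "sech_transform p t = (LINT x|lborel. (1 / cosh (pi * x)) ^ p * cos (x * t))"

lemma integrable_sech_power_cos:
  assumes "p \<ge> 1"
  shows "integrable lborel (\<lambda>x::real. (1 / cosh (pi * x)) ^ p * cos (x * t))"
  using integrable_sech_power(1)[OF assms]
  by (rule Bochner_Integration.integrable_bound)
     (auto simp: abs_mult cosh_def intro!: mult_left_le)

text \<open>
  The hyperbolic secant is its own Fourier transform up to scaling. This is why the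
  Hilbert matrix is exactly, and not only approximately, the first of the kernels below.
\<close>

lemma sech_transform_1: "sech_transform 1 t = 1 / cosh (t / 2)"
proof -
  have "sech_transform 1 t = \<bar>1 / (2 * pi)\<bar> *\<^sub>R (LINT x|lborel. (1 / cosh (pi * (0 + (1 / (2 * pi)) * x))) ^ 1 * cos ((0 + (1 / (2 * pi)) * x) * t))"
    unfolding sech_transform_def by (rule lborel_integral_real_affine) auto
  also have "(\<lambda>x. (1 / cosh (pi * (0 + (1 / (2 * pi)) * x))) ^ 1 * cos ((0 + (1 / (2 * pi)) * x) * t)) =
     (\<lambda>x. cos (t / (2 * pi) * x) / cosh (x / 2))"
    by (intro ext) (simp add: mult.commute)
  also have "integral\<^sup>L lborel \<dots> = 2 * pi / cosh (t / 2)"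
    by (subst sech_fourier(1)) simp
  finally show ?thesis by simp
qed

lemma sech_transform_abs_le:
  assumes "p \<ge> 1" shows "\<bar>sech_transform p t\<bar> \<le> sech_transform p 0"
proof -
  have "norm (sech_transform p t) \<le> (LINT x|lborel. norm ((1 / cosh (pi * x)) ^ p * cos (x * t)))"
    unfolding sech_transform_def by (rule integral_norm_bound)
  also have "\<dots> \<le> (LINT x|lborel. (1 / cosh (pi * x)) ^ p)"
    using integrable_sech_power_cos[OF assms] integrable_sech_power(1)[OF assms]
    by (intro integral_mono integrable_norm) (auto simp: abs_mult cosh_def intro!: mult_left_le)
  finally show ?thesis by (simp add: sech_transform_def)
qed

lemma sech_transform_lipschitz:
  assumes "p \<ge> 1" 
  shows "\<bar>sech_transform p t - sech_transform p s\<bar> \<le> (LINT x|lborel. \<bar>x\<bar> * (1 / cosh (pi * x)) ^ p) * \<bar>t - s\<bar>"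
proof -
  have *: "\<bar>cos (x * t) - cos (x * s)\<bar> \<le> \<bar>x\<bar> * \<bar>t - s\<bar>" for x
  proof -
    have "\<bar>cos (x * t) - cos (x * s)\<bar> = 2 * \<bar>sin ((x * t + x * s) / 2)\<bar> * \<bar>sin ((x * s - x * t) / 2)\<bar>"
      by (simp add: cos_diff_cos abs_mult)
    also have "\<dots> \<le> 2 * 1 * \<bar>(x * s - x * t) / 2\<bar>"
      by (intro mult_mono abs_sin_x_le_abs_x) auto
    also have "\<dots> = \<bar>x\<bar> * \<bar>t - s\<bar>"
      by (simp add: abs_minus_commute flip: abs_mult right_diff_distrib)
    finally show ?thesis .
  qed
  have "sech_transform p t - sech_transform p s = (LINT x|lborel. (1 / cosh (pi * x)) ^ p * cos (x * t) - (1 / cosh (pi * x)) ^ p * cos (x * s))"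
    unfolding sech_transform_def using integrable_sech_power_cos[OF assms] by (intro Bochner_Integration.integral_diff[symmetric])
  then have "norm (sech_transform p t - sech_transform p s) \<le> (LINT x|lborel. norm ((1 / cosh (pi * x)) ^ p * cos (x * t) - (1 / cosh (pi * x)) ^ p * cos (x * s)))"
    using integral_norm_bound by (rule ord_eq_le_trans[OF arg_cong[where f = norm]])
  also have "\<dots> \<le> (LINT x|lborel. (\<bar>x\<bar> * (1 / cosh (pi * x)) ^ p) * \<bar>t - s\<bar>)"
  proof (intro integral_mono integrable_norm Bochner_Integration.integrable_diff integrable_sech_power_cos[OF assms]
      integrable_mult_left impI integrable_sech_power(2)[OF assms])
    fix x :: real
    have "norm ((1 / cosh (pi * x)) ^ p * cos (x * t) - (1 / cosh (pi * x)) ^ p * cos (x * s))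
       = (1 / cosh (pi * x)) ^ p * \<bar>cos (x * t) - cos (x * s)\<bar>"
      by (simp add: abs_mult cosh_def flip: right_diff_distrib)
    also have "\<dots> \<le> (1 / cosh (pi * x)) ^ p * (\<bar>x\<bar> * \<bar>t - s\<bar>)"
      by (intro mult_left_mono *) (simp add: cosh_def)
    finally show "norm ((1 / cosh (pi * x)) ^ p * cos (x * t) - (1 / cosh (pi * x)) ^ p * cos (x * s))
       \<le> (\<bar>x\<bar> * (1 / cosh (pi * x)) ^ p) * \<bar>t - s\<bar>" by (simp add: mult_ac)
  qed
  also have "\<dots> = (LINT x|lborel. \<bar>x\<bar> * (1 / cosh (pi * x)) ^ p) * \<bar>t - s\<bar>"
    by simp
  finally show ?thesis by simp
qed

lemma sech_transform_measurable [measurable]: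
  assumes "p \<ge> 1" shows "sech_transform p \<in> borel_measurable borel"
proof (rule borel_measurable_continuous_onI)
  define L where "L = (LINT x|lborel. \<bar>x\<bar> * (1 / cosh (pi * x)) ^ p)"
  have "L \<ge> 0" unfolding L_def by (intro integral_nonneg_AE) (simp add: cosh_def)
  then have "L-lipschitz_on UNIV (sech_transform p)"
    using sech_transform_lipschitz[OF assms] by (auto intro!: lipschitz_onI simp: dist_real_def L_def)
  then show "continuous_on UNIV (sech_transform p)"
    by (rule lipschitz_on_continuous_on)
qed

lemma integrable_sech_transform_conv:
  assumes "p \<ge> 1"
  shows "integrable lborel (\<lambda>s. sech_transform p s / cosh ((t - s) / 2))"
proof (rule Bochner_Integration.integrable_bound)
  show "integrable lborel (\<lambda>s. sech_transform p 0 * (1 / cosh (1/2 * (t + (-1) * s))))"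
    by (intro integrable_mult_right lborel_integrable_real_affine integrable_sech) auto
  show "(\<lambda>s. sech_transform p s / cosh ((t - s) / 2)) \<in> borel_measurable lborel"
    using sech_transform_measurable[OF assms] by measurable
  have "sech_transform p 0 \<ge> 0" using sech_transform_abs_le[OF assms, of 0] by linarith
  then show "AE s in lborel. norm (sech_transform p s / cosh ((t - s) / 2)) \<le> norm (sech_transform p 0 * (1 / cosh (1/2 * (t + (-1) * s))))"
    using sech_transform_abs_le[OF assms] by (intro AE_I2) (auto simp: abs_mult intro!: divide_right_mono)
qed

text \<open>
  Multiplication by one more hyperbolic secant on the Fourier side is convolution here: insert
  the Fourier integral of \<open>sech_transform p\<close>, exchange the integrals, and evaluate the inner one by
  \<open>sech_fourier\<close>, where the sine part vanishes by symmetry.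
\<close>

lemma sech_transform_Suc:
  assumes "p \<ge> 1"
  shows "sech_transform (Suc p) t = 1 / (2 * pi) * (LINT s|lborel. sech_transform p s / cosh ((t - s) / 2))"
proof -
  let ?h = "\<lambda>x s. (1 / cosh (pi * x)) ^ p * (cos (x * s) / cosh ((t - s) / 2)) :: real"
  have c: "integrable lborel (\<lambda>s. 1 / cosh ((t - s) / 2))" "(LINT s|lborel. 1 / cosh ((t - s) / 2)) = 2 * pi"
  proof -
    have "integrable lborel (\<lambda>s. 1 / cosh (1/2 * (t + (-1) * s)))"
      by (intro lborel_integrable_real_affine integrable_sech) auto
    then show "integrable lborel (\<lambda>s. 1 / cosh ((t - s) / 2))" by simp
    show "(LINT s|lborel. 1 / cosh ((t - s) / 2)) = 2 * pi"
      using sech_fourier(1)[of 0] lborel_integral_real_affine[of "-1" "\<lambda>s. 1 / cosh (s / 2)" t] by simp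
  qed
  have int1: "integrable lborel (\<lambda>s. cos (x * s) / cosh ((t - s) / 2))" for x
    by (rule Bochner_Integration.integrable_bound[OF c(1)]) (auto intro!: AE_I2 divide_right_mono)
  have [measurable]: "(\<lambda>(x, s). ?h x s) \<in> borel_measurable (lborel \<Otimes>\<^sub>M lborel)"
    by measurable
  have int: "integrable (lborel \<Otimes>\<^sub>M lborel) (\<lambda>(x, s). ?h x s)"
  proof (rule lborel_pair.Fubini_integrable)
    show "integrable lborel (\<lambda>x. LINT s|lborel. norm (case (x, s) of (x, s) \<Rightarrow> ?h x s))"
    proof (rule Bochner_Integration.integrable_bound)
      show "integrable lborel (\<lambda>x::real. (1 / cosh (pi * x)) ^ p * (2 * pi))"
        by (intro integrable_mult_left integrable_sech_power assms)
      have "(LINT s|lborel. norm (?h x s)) \<le> (1 / cosh (pi * x)) ^ p * (2 * pi)" for x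
      proof -
        have "(LINT s|lborel. norm (?h x s)) \<le> (LINT s|lborel. (1 / cosh (pi * x)) ^ p * (1 / cosh ((t - s) / 2)))"
          using int1 c(1) by (intro integral_mono integrable_norm integrable_mult_right)
            (auto simp: abs_mult cosh_def intro!: mult_left_mono divide_right_mono)
        also have "\<dots> = (1 / cosh (pi * x)) ^ p * (2 * pi)" by (simp only: integral_mult_right_zero c(2))
        finally show ?thesis .
      qed
      moreover have "0 \<le> (LINT s|lborel. norm (?h x s))" for x by simp
      moreover have "0 \<le> (1 / cosh (pi * x)) ^ p * (2 * pi)" for x :: real by (simp add: cosh_def)
      ultimately show "AE x in lborel. norm (LINT s|lborel. norm (case (x, s) of (x, s) \<Rightarrow> ?h x s)) \<le> norm ((1 / cosh (pi * x)) ^ p * (2 * pi))"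
        by (intro AE_I2) (simp only: prod.case real_norm_def abs_of_nonneg)
    qed measurable
    show "AE x in lborel. integrable lborel (\<lambda>s. case (x, s) of (x, s) \<Rightarrow> ?h x s)"
      using int1 by (intro AE_I2) (simp only: prod.case integrable_mult_right)
  qed measurable
  have "(LINT s|lborel. sech_transform p s / cosh ((t - s) / 2)) = (LINT s|lborel. (LINT x|lborel. ?h x s))"
    unfolding sech_transform_def by (simp flip: integral_divide_zero)
  also have "\<dots> = (LINT x|lborel. (LINT s|lborel. ?h x s))"
    using lborel_pair.Fubini_integral[OF int] by simp
  also have "\<dots> = (LINT x|lborel. 2 * pi * ((1 / cosh (pi * x)) ^ Suc p * cos (x * t)))"
  proof (rule Bochner_Integration.integral_cong[OF refl])
    fix x :: real
    have j: "integrable lborel (\<lambda>w::real. 1 / cosh (w / 2))"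
      using integrable_sech[of "1/2"] by simp
    have i: "integrable lborel (\<lambda>w. cos (x * w) / cosh (w / 2))" "integrable lborel (\<lambda>w. sin (x * w) / cosh (w / 2))"
      by (rule Bochner_Integration.integrable_bound[OF j]; auto intro!: divide_right_mono)+
    have "(LINT s|lborel. cos (x * s) / cosh ((t - s) / 2)) = (LINT w|lborel. cos (x * (t + -1 * w)) / cosh (w / 2))"
      using lborel_integral_real_affine[of "-1" "\<lambda>s. cos (x * s) / cosh ((t - s) / 2)" t] by simp
    also have "\<dots> = (LINT w|lborel. cos (x * t) * (cos (x * w) / cosh (w / 2)) + sin (x * t) * (sin (x * w) / cosh (w / 2)))"
      by (rule Bochner_Integration.integral_cong[OF refl]) (simp add: cos_diff right_diff_distrib add_divide_distrib)
    also have "\<dots> = cos (x * t) * (2 * pi / cosh (pi * x))"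
      by (simp only: Bochner_Integration.integral_add integrable_mult_right i integral_mult_right_zero
          sech_fourier)
    finally show "(LINT s|lborel. ?h x s) = 2 * pi * ((1 / cosh (pi * x)) ^ Suc p * cos (x * t))"
      by (simp only: integral_mult_right_zero) simp
  qed
  also have "\<dots> = 2 * pi * sech_transform (Suc p) t"
    unfolding sech_transform_def by (simp only: integral_mult_right_zero)
  finally show ?thesis by simp
qed

text \<open>
  By induction through the convolution formula. The kernel decays like \<open>exp (- \<bar>t\<bar> / 2)\<close>; giving up half
  of that rate makes the triangle inequality absorb the convolution, so that the same rate \<open>1/4\<close>
  persists for all \<open>p\<close>.
\<close>

lemma sech_transform_decay:
  assumes "p \<ge> 1"
  obtains D where "D > 0" "\<And>t. \<bar>sech_transform p t\<bar> \<le> D * exp (- \<bar>t\<bar> / 4)"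
proof -
  have "\<exists>D>0. \<forall>t. \<bar>sech_transform p t\<bar> \<le> D * exp (- \<bar>t\<bar> / 4)"
    using assms
  proof (induction p rule: dec_induct)
    case base
    have "\<bar>sech_transform 1 t\<bar> \<le> 2 * exp (- \<bar>t\<bar> / 4)" for t
    proof -
      have "\<bar>sech_transform 1 t\<bar> \<le> 2 * exp (- \<bar>t / 2\<bar>)"
        using sech_le_exp[of "t / 2"] by (simp only: sech_transform_1) (simp add: cosh_def)
      also have "\<dots> \<le> 2 * exp (- \<bar>t\<bar> / 4)" by simp
      finally show ?thesis .
    qed
    then show ?case by (intro exI[of _ 2]) auto
  next
    case (step p)
    then obtain D where D: "D > 0" "\<And>t. \<bar>sech_transform p t\<bar> \<le> D * exp (- \<bar>t\<bar> / 4)" by blast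
    define I :: real where "I = (LINT s|lborel. exp (- (1/4 * \<bar>s::real\<bar>)))"
    have I: "I \<ge> 0" unfolding I_def by simp
    have "\<bar>sech_transform (Suc p) t\<bar> \<le> (D * 2 * I + 1) * exp (- \<bar>t\<bar> / 4)" for t
    proof -
      have int: "integrable lborel (\<lambda>s. exp (- (1/4 * \<bar>t + (-1) * s\<bar>)))"
        by (intro lborel_integrable_real_affine integrable_exp_neg_abs) auto
      have pt: "\<bar>sech_transform p s / cosh ((t - s) / 2)\<bar> \<le> (D * 2 * exp (- \<bar>t\<bar> / 4)) * exp (- (1/4 * \<bar>t + (-1) * s\<bar>))" for s
      proof -
        have "\<bar>sech_transform p s / cosh ((t - s) / 2)\<bar> = \<bar>sech_transform p s\<bar> * (1 / cosh ((t - s) / 2))"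
          by simp
        also have "\<dots> \<le> (D * exp (- \<bar>s\<bar> / 4)) * (2 * exp (- \<bar>(t - s) / 2\<bar>))"
          using D by (intro mult_mono sech_le_exp) auto
        also have "\<dots> = D * 2 * exp (- \<bar>s\<bar> / 4 + - \<bar>(t - s) / 2\<bar>)"
          by (simp only: exp_add mult_ac)
        also have "\<dots> \<le> D * 2 * exp (- \<bar>t\<bar> / 4 + - (1/4 * \<bar>t + (-1) * s\<bar>))"
        proof -
          have "\<bar>t\<bar> \<le> \<bar>s\<bar> + \<bar>t - s\<bar>" by linarith
          then have "- \<bar>s\<bar> / 4 + - \<bar>(t - s) / 2\<bar> \<le> - \<bar>t\<bar> / 4 + - (1/4 * \<bar>t + (-1) * s\<bar>)"
            by (simp add: field_simps)
          then show ?thesis using D by (intro mult_left_mono) auto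
        qed
        finally show ?thesis by (simp only: exp_add mult_ac)
      qed
      have "\<bar>LINT s|lborel. sech_transform p s / cosh ((t - s) / 2)\<bar> \<le> (LINT s|lborel. \<bar>sech_transform p s / cosh ((t - s) / 2)\<bar>)"
        using integral_norm_bound[of lborel "\<lambda>s. sech_transform p s / cosh ((t - s) / 2)"] by simp
      also have "\<dots> \<le> (LINT s|lborel. (D * 2 * exp (- \<bar>t\<bar> / 4)) * exp (- (1/4 * \<bar>t + (-1) * s\<bar>)))"
        by (intro integral_mono integrable_abs integrable_sech_transform_conv integrable_mult_right int pt) (use step in auto)
      also have "\<dots> = (D * 2 * exp (- \<bar>t\<bar> / 4)) * I"
        using lborel_integral_real_affine[of "-1" "\<lambda>s. exp (- (1/4 * \<bar>s\<bar>))" t]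
        by (simp only: integral_mult_right_zero I_def) simp
      finally have *: "\<bar>LINT s|lborel. sech_transform p s / cosh ((t - s) / 2)\<bar> \<le> D * 2 * exp (- \<bar>t\<bar> / 4) * I" .
      have "\<bar>sech_transform (Suc p) t\<bar> = 1 / (2 * pi) * \<bar>LINT s|lborel. sech_transform p s / cosh ((t - s) / 2)\<bar>"
        using step by (simp only: sech_transform_Suc abs_mult) simp
      also have "\<dots> \<le> 1 * (D * 2 * exp (- \<bar>t\<bar> / 4) * I)"
        using * pi_ge_two by (intro mult_mono) auto
      also have "\<dots> \<le> (D * 2 * I + 1) * exp (- \<bar>t\<bar> / 4)" by (simp add: distrib_right)
      finally show ?thesis .
    qed
    moreover have "D * 2 * I + 1 > 0" using D I by (simp add: add_nonneg_pos)
    ultimately show ?case by blast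
  qed
  then show ?thesis using that by blast
qed

lemma sech_transform_2_at_0: "sech_transform 2 0 = 2 / pi"
proof -
  have d: "((\<lambda>x. tanh (pi * x) / pi) has_real_derivative (1 / cosh (pi * x))\<^sup>2) (at x)" for x
  proof -
    have "1 - (tanh (pi * x))\<^sup>2 = ((cosh (pi * x))\<^sup>2 - (sinh (pi * x))\<^sup>2) / (cosh (pi * x))\<^sup>2"
      by (simp add: tanh_def power_divide diff_divide_distrib)
    then have "1 - (tanh (pi * x))\<^sup>2 = (1 / cosh (pi * x))\<^sup>2"
      by (simp add: hyperbolic_pythagoras power_divide)
    moreover have "((\<lambda>x. tanh (pi * x) / pi) has_real_derivative 1 - (tanh (pi * x))\<^sup>2) (at x)"
      by (auto intro!: derivative_eq_intros)
    ultimately show ?thesis by simp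
  qed
  have "(LINT x|lborel. (1 / cosh (pi * x))\<^sup>2) = 1 / pi - (- 1 / pi)"
  proof (rule integral_on_line_of_nonneg_derivative(2)[OF d])
    show "((\<lambda>x. tanh (pi * x) / pi) \<longlongrightarrow> - 1 / pi) at_bot"
      by (intro tendsto_divide filterlim_compose[OF tanh_real_at_bot] tendsto_const) (real_asymp | simp)+
    show "((\<lambda>x. tanh (pi * x) / pi) \<longlongrightarrow> 1 / pi) at_top"
      by (intro tendsto_divide filterlim_compose[OF tanh_real_at_top] tendsto_const) (real_asymp | simp)+
  qed (auto intro!: continuous_intros)
  then show ?thesis by (simp add: sech_transform_def)
qed

text \<open>
  Integration by parts: the derivative of \<open>sinh u / cosh u ^ (p + 1)\<close> is
  \<open>(p + 1) / cosh u ^ (p + 2) - p / cosh u ^ p\<close>, and it integrates to zero.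
\<close>

lemma sech_transform_recurrence_at_0:
  assumes "p \<ge> 1"
  shows "sech_transform (p + 2) 0 = real p / real (p + 1) * sech_transform p 0"
proof -
  let ?F = "\<lambda>x. sinh (pi * x) * (1 / cosh (pi * x)) ^ Suc p / pi"
  let ?f = "\<lambda>x. real (p + 1) * (1 / cosh (pi * x)) ^ (p + 2) - real p * (1 / cosh (pi * x)) ^ p :: real"
  have int: "integrable lborel ?f"
    using assms by (intro Bochner_Integration.integrable_diff integrable_mult_right integrable_sech_power) auto
  have F: "(?F has_real_derivative ?f x) (at x)" for x
  proof -
    define c s where "c = cosh (pi * x)" and "s = sinh (pi * x)"
    have cs: "c > 0" "s * s = c * c - 1"
      using hyperbolic_pythagoras[of "pi * x"] by (simp_all add: c_def s_def power2_eq_square algebra_simps)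
    have "((\<lambda>x. 1 / cosh (pi * x)) has_real_derivative - (s * pi) / (c * c)) (at x)"
      by (auto intro!: derivative_eq_intros simp: c_def s_def)
    from DERIV_power[OF this, of "Suc p"]
    have "((\<lambda>x. (1 / cosh (pi * x)) ^ Suc p) has_real_derivative
        real (Suc p) * ((1 / c) ^ p * (- (s * pi) / (c * c)))) (at x)"
      by (simp add: c_def mult_ac)
    moreover have "((\<lambda>x. sinh (pi * x)) has_real_derivative c * pi) (at x)"
      by (auto intro!: derivative_eq_intros simp: c_def)
    ultimately have "(?F has_real_derivative
        (c * pi * (1 / c) ^ Suc p + real (Suc p) * ((1 / c) ^ p * (- (s * pi) / (c * c))) * s) / pi) (at x)"
      unfolding c_def s_def by (intro DERIV_cdivide DERIV_mult)
    also have "(c * pi * (1 / c) ^ Suc p + real (Suc p) * ((1 / c) ^ p * (- (s * pi) / (c * c))) * s) / pi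
        = (1 / c) ^ p * (1 - real (Suc p) * ((s * s) / (c * c)))"
      using cs(1) by (simp add: field_simps)
    also have "\<dots> = real (p + 1) * (1 / c) ^ (p + 2) - real p * (1 / c) ^ p"
      unfolding cs(2) using cs(1) by (simp add: field_simps power2_eq_square)
    finally show ?thesis by (simp only: c_def)
  qed
  have lim: "(?F \<longlongrightarrow> 0) G" if "filterlim (\<lambda>x::real. \<bar>x\<bar>) at_top G" for G
  proof (rule Lim_null_comparison)
    have "((\<lambda>x::real. 2 * exp (- x)) \<longlongrightarrow> 0) at_top" by real_asymp
    from filterlim_compose[OF this that] show "((\<lambda>x::real. 2 * exp (- \<bar>x\<bar>)) \<longlongrightarrow> 0) G" .
    have "norm (?F x) \<le> 2 * exp (- \<bar>x\<bar>)" for x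
    proof -
      have "\<bar>sinh (pi * x)\<bar> \<le> cosh (pi * x)"
        using sinh_le_cosh_real[of "pi * x"] sinh_le_cosh_real[of "- (pi * x)"] by (simp add: abs_le_iff)
      then have "\<bar>sinh (pi * x)\<bar> * (1 / cosh (pi * x)) ^ Suc p \<le> cosh (pi * x) * (1 / cosh (pi * x)) ^ Suc p"
        by (intro mult_right_mono) auto
      also have "\<dots> = (1 / cosh (pi * x)) ^ p" by simp
      also have "\<dots> \<le> 2 * exp (- \<bar>x\<bar>)" using sech_power_bounds(1)[OF assms, of x] by simp
      finally have "\<bar>sinh (pi * x)\<bar> * (1 / cosh (pi * x)) ^ Suc p / pi \<le> 2 * exp (- \<bar>x\<bar>) / 1"
        using pi_ge_two by (intro frac_le) auto
      then show ?thesis by (simp add: abs_mult power_abs)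
    qed
    then show "\<forall>\<^sub>F x in G. norm (?F x) \<le> 2 * exp (- \<bar>x\<bar>)" by simp
  qed
  have "(LBINT x=-\<infinity>..\<infinity>. ?f x) = 0 - 0"
  proof (rule interval_integral_FTC_integrable[where F = ?F])
    show "(?F has_vector_derivative ?f x) (at x)" for x
      using F by (simp only: has_real_derivative_iff_has_vector_derivative)
    show "isCont ?f x" for x by (auto intro!: continuous_intros)
    show "set_integrable lborel (einterval (- \<infinity>) \<infinity>) ?f"
      using int by (simp add: set_integrable_def)
    show "((?F \<circ> real_of_ereal) \<longlongrightarrow> 0) (at_right (-\<infinity>))"
      unfolding ereal_tendsto_simps by (rule lim) real_asymp
    show "((?F \<circ> real_of_ereal) \<longlongrightarrow> 0) (at_left \<infinity>)"
      unfolding ereal_tendsto_simps by (rule lim) real_asymp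
  qed simp
  then have "integral\<^sup>L lborel ?f = 0"
    by (simp add: interval_integral_to_infinity_eq interval_lebesgue_integral_def set_lebesgue_integral_def)
  also have "integral\<^sup>L lborel ?f = real (p + 1) * sech_transform (p + 2) 0 - real p * sech_transform p 0"
    using integrable_sech_power(1)[of p] integrable_sech_power(1)[of "p + 2"] assms
    by (simp only: sech_transform_def Bochner_Integration.integral_diff integrable_mult_right integral_mult_right_zero
        trans_le_add1) simp
  finally show ?thesis by (simp add: field_simps)
qed

section \<open>Sums over half-integers and integrals in the logarithmic variable\<close>

text \<open>
  The midpoints \<open>n + 1/2\<close>: the Hilbert matrix is \<open>1 / (pi * (x + y))\<close> at these points, and sums over
  them compare well with integrals over the half-line.
\<close>

definition node :: "nat \<Rightarrow> real" where "node n = real n + 1 / 2"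

lemma node_pos [simp]: "node n > 0" and node_nonneg [simp]: "node n \<ge> 0"
  and node_ge_half: "1 / 2 \<le> node n" and node_Suc: "node (Suc n) = node n + 1"
  by (simp_all add: node_def)

lemma node_nonzero [simp]: "node n \<noteq> 0"
  using node_pos[of n] by linarith

lemma node_mono: "m \<le> n \<Longrightarrow> node m \<le> node n"
  by (simp add: node_def)

lemma hilbert_matrix_node: "hilbert_matrix n m = 1 / (pi * (node n + node m))"
  by (simp add: hilbert_matrix_def node_def)

lemma hilbert_matrix_nonneg [simp]: "0 \<le> hilbert_matrix n m"
  by (simp add: hilbert_matrix_node add_pos_pos less_imp_le)

text \<open>
  The interval between consecutive nodes, in the logarithmic variable. The measure \<open>exp t dt\<close> gives
  every cell mass one, so that a sum over nodes is a step-function integral without any change of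
  variables.
\<close>

definition cell :: "nat \<Rightarrow> real set" where
  "cell j = {ln (node j)..<ln (node (Suc j))}"

lemma cell_measurable [measurable]: "cell j \<in> sets borel" "cell j \<in> sets lborel"
  by (simp_all add: cell_def)

lemma cell_iff: "t \<in> cell j \<longleftrightarrow> node j \<le> exp t \<and> exp t < node j + 1"
proof -
  have "ln (node j) \<le> t \<longleftrightarrow> node j \<le> exp t"
    by (metis exp_le_cancel_iff exp_ln node_pos)
  moreover have "t < ln (node (Suc j)) \<longleftrightarrow> exp t < node (Suc j)"
    by (metis exp_less_cancel_iff exp_ln node_pos)
  ultimately show ?thesis by (simp add: cell_def node_Suc)
qed

lemma disjoint_cells: "i \<noteq> j \<Longrightarrow> cell i \<inter> cell j = {}"
proof -
  have "cell i \<inter> cell j = {}" if "i < j" for i j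
  proof -
    have "ln (node (Suc i)) \<le> ln (node j)"
      using that by (intro ln_mono node_mono) auto
    then show ?thesis by (auto simp: cell_def)
  qed
  then show "i \<noteq> j \<Longrightarrow> cell i \<inter> cell j = {}"
    by (metis Int_commute linorder_neqE_nat)
qed

lemma Union_cells: "(\<Union>j. cell j) = {ln (1 / 2)..}"
proof (intro equalityI subsetI)
  fix t assume "t \<in> {ln (1 / 2 :: real)..}"
  then have "exp (ln (1 / 2)) \<le> exp t" by (simp only: exp_le_cancel_iff atLeast_iff)
  then have t: "1 / 2 \<le> exp t" by simp
  define j where "j = nat \<lfloor>exp t - 1 / 2\<rfloor>"
  have "real j \<le> exp t - 1 / 2" "exp t - 1 / 2 < real j + 1"
    using t unfolding j_def by linarith+
  then have "node j \<le> exp t" "exp t < node (Suc j)" by (simp_all add: node_def)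
  then have "t \<in> cell j"
    by (simp add: cell_iff node_Suc)
  then show "t \<in> (\<Union>j. cell j)" by blast
next
  fix t assume "t \<in> (\<Union>j. cell j)"
  then obtain j where "t \<in> cell j" by blast
  then have "ln (node j) \<le> t" by (simp add: cell_def)
  moreover have "ln (1 / 2) \<le> ln (node j)" using node_ge_half by (intro ln_mono) auto
  ultimately show "t \<in> {ln (1 / 2)..}" unfolding atLeast_iff by linarith
qed

lemma cell_integral:
  "integrable lborel (\<lambda>t. indicator (cell j) t * exp t)" "(LINT t|lborel. indicator (cell j) t * exp t) = (1::real)"
proof -
  let ?a = "ln (node j)" let ?b = "ln (node (Suc j))"
  have "?a \<le> ?b" by (intro ln_mono) (auto simp: node_Suc)
  then have "has_bochner_integral lborel (\<lambda>x. exp x * indicator {?a..?b} x) (exp ?b - exp ?a)"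
    by (intro has_bochner_integral_FTC_Icc_real) (auto intro!: derivative_eq_intros)
  then have "has_bochner_integral lborel (\<lambda>x. exp x * indicator {?a..?b} x) 1"
    by (simp add: node_Suc add_pos_pos)
  moreover have "AE x in lborel. exp x * indicator {?a..?b} x = indicator (cell j) x * exp x"
    using AE_lborel_singleton[of ?b] by eventually_elim (auto simp: cell_def split: split_indicator)
  ultimately have "has_bochner_integral lborel (\<lambda>x. indicator (cell j) x * exp x) 1"
    by (subst (asm) has_bochner_integral_cong_AE) auto
  then show "integrable lborel (\<lambda>t. indicator (cell j) t * exp t)" "(LINT t|lborel. indicator (cell j) t * exp t) = (1::real)"
    by (simp_all add: has_bochner_integral_iff)
qed

lemma integrable_indicator_times:
  fixes G :: "real \<Rightarrow> real"
  assumes "integrable lborel G" "A \<in> sets borel"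
  shows "integrable lborel (\<lambda>t. indicator A t * G t)"
  using integrable_mult_indicator[of A lborel G] assms by simp

text \<open>
  Quadrature error, cell by cell. The cells leave out the half-line to the left of \<open>ln (1/2)\<close>, whose
  contribution appears as the last term.
\<close>

lemma node_sum_integral_error:
  fixes \<phi> :: "real \<Rightarrow> real"
  assumes int: "integrable lborel (\<lambda>t. exp t * \<phi> (exp t))"
    and b: "\<And>j t. t \<in> cell j \<Longrightarrow> \<bar>\<phi> (node j) - \<phi> (exp t)\<bar> \<le> b j"
    and sb: "summable b" and s\<phi>: "summable (\<lambda>j. \<phi> (node j))"
  shows "\<bar>(\<Sum>j. \<phi> (node j)) - (LINT t|lborel. exp t * \<phi> (exp t))\<bar>
      \<le> (\<Sum>j. b j) + \<bar>LINT t|lborel. indicator {..<ln (1 / 2)} t * (exp t * \<phi> (exp t))\<bar>"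
proof -
  let ?G = "\<lambda>t. exp t * \<phi> (exp t)"
  define g where "g j = (LINT t|lborel. indicator (cell j) t * ?G t)" for j
  have intj: "integrable lborel (\<lambda>t. indicator (cell j) t * ?G t)" for j
    by (intro integrable_indicator_times int) measurable
  have diff: "\<bar>\<phi> (node j) - g j\<bar> \<le> b j" for j
  proof -
    have i1: "integrable lborel (\<lambda>t. \<phi> (node j) * (indicator (cell j) t * exp t))"
      by (intro integrable_mult_right cell_integral)
    have "\<phi> (node j) - g j = (LINT t|lborel. \<phi> (node j) * (indicator (cell j) t * exp t) - indicator (cell j) t * ?G t)"
      unfolding g_def Bochner_Integration.integral_diff[OF i1 intj] by (simp only: integral_mult_right_zero cell_integral mult_1_right)
    then have "\<bar>\<phi> (node j) - g j\<bar> \<le> (LINT t|lborel. norm (\<phi> (node j) * (indicator (cell j) t * exp t) - indicator (cell j) t * ?G t))"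
      using integral_norm_bound[of lborel "\<lambda>t. \<phi> (node j) * (indicator (cell j) t * exp t) - indicator (cell j) t * ?G t"]
      by (simp only: real_norm_def)
    also have "\<dots> \<le> (LINT t|lborel. b j * (indicator (cell j) t * exp t))"
    proof (rule integral_mono)
      show "integrable lborel (\<lambda>t. norm (\<phi> (node j) * (indicator (cell j) t * exp t) - indicator (cell j) t * ?G t))"
        by (intro integrable_norm Bochner_Integration.integrable_diff i1 intj)
      show "integrable lborel (\<lambda>t. b j * (indicator (cell j) t * exp t))"
        by (intro integrable_mult_right cell_integral)
      fix t
      have "norm (\<phi> (node j) * (indicator (cell j) t * exp t) - indicator (cell j) t * ?G t)
        = indicator (cell j) t * exp t * \<bar>\<phi> (node j) - \<phi> (exp t)\<bar>"
        by (auto split: split_indicator simp: abs_mult right_diff_distrib[symmetric] mult.commute simp flip: left_diff_distrib)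
      also have "\<dots> \<le> indicator (cell j) t * exp t * b j"
        using b[of t j] by (auto split: split_indicator)
      finally show "norm (\<phi> (node j) * (indicator (cell j) t * exp t) - indicator (cell j) t * ?G t)
          \<le> b j * (indicator (cell j) t * exp t)" by (simp add: mult_ac)
    qed
    also have "\<dots> = b j" by (simp only: integral_mult_right_zero cell_integral mult_1_right)
    finally show ?thesis .
  qed
  have sd: "summable (\<lambda>j. \<bar>\<phi> (node j) - g j\<bar>)"
    by (rule summable_comparison_test[OF _ sb]) (use diff in auto)
  have sd': "summable (\<lambda>j. \<phi> (node j) - g j)" using sd by (rule summable_rabs_cancel)
  have sg: "summable g"
    using summable_diff[OF s\<phi> sd'] by simp
  have "(\<Sum>j. g j) = (LINT t|lborel. indicator {ln (1 / 2)..} t * ?G t)"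
  proof -
    have "set_integrable lborel (\<Union>j. cell j) ?G"
      unfolding set_integrable_def Union_cells using integrable_indicator_times[OF int, of "{ln (1/2)..}"] by simp
    from lebesgue_integral_countable_add[OF _ disjoint_cells this]
    show ?thesis by (simp add: set_lebesgue_integral_def Union_cells g_def)
  qed
  also have "\<dots> = (LINT t|lborel. ?G t - indicator {..<ln (1 / 2)} t * ?G t)"
    by (intro Bochner_Integration.integral_cong refl) (auto split: split_indicator)
  also have "\<dots> = (LINT t|lborel. ?G t) - (LINT t|lborel. indicator {..<ln (1 / 2)} t * ?G t)"
    by (intro Bochner_Integration.integral_diff int integrable_indicator_times) auto
  finally have "(\<Sum>j. \<phi> (node j)) - (LINT t|lborel. ?G t)
      = (\<Sum>j. \<phi> (node j) - g j) - (LINT t|lborel. indicator {..<ln (1 / 2)} t * ?G t)"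
    using suminf_diff[OF s\<phi> sg] by simp
  moreover have "\<bar>\<Sum>j. \<phi> (node j) - g j\<bar> \<le> (\<Sum>j. b j)"
    using summable_rabs[OF sd] suminf_le[OF diff sd sb] by linarith
  ultimately show ?thesis by linarith
qed

lemma node_sum_le_integral:
  fixes \<phi> :: "real \<Rightarrow> real"
  assumes int: "integrable lborel (\<lambda>t. exp t * \<phi> (exp t))"
    and nonneg: "\<And>y. y > 0 \<Longrightarrow> 0 \<le> \<phi> y"
    and c: "\<And>j t. t \<in> cell j \<Longrightarrow> \<phi> (node j) \<le> c * \<phi> (exp t)" "c \<ge> 0"
  shows "summable (\<lambda>j. \<phi> (node j))" "(\<Sum>j. \<phi> (node j)) \<le> c * (LINT t|lborel. exp t * \<phi> (exp t))"
proof -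
  let ?G = "\<lambda>t. exp t * \<phi> (exp t)"
  have intj: "integrable lborel (\<lambda>t. indicator (cell j) t * ?G t)" for j
    by (intro integrable_indicator_times int) measurable
  have *: "\<phi> (node j) \<le> c * (LINT t|lborel. indicator (cell j) t * ?G t)" for j
  proof -
    have "\<phi> (node j) = (LINT t|lborel. \<phi> (node j) * (indicator (cell j) t * exp t))"
      by (simp only: integral_mult_right_zero cell_integral mult_1_right)
    also have "\<dots> \<le> (LINT t|lborel. c * (indicator (cell j) t * ?G t))"
      using c(1)[of _ j] by (intro integral_mono integrable_mult_right intj cell_integral) (auto split: split_indicator simp: mult_ac)
    finally show ?thesis by (simp only: integral_mult_right_zero)
  qed
  have part: "(\<Sum>j<M. \<phi> (node j)) \<le> c * (LINT t|lborel. ?G t)" for M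
  proof -
    have "(\<Sum>j<M. \<phi> (node j)) \<le> (\<Sum>j<M. c * (LINT t|lborel. indicator (cell j) t * ?G t))"
      by (intro sum_mono *)
    also have "\<dots> = c * (LINT t|lborel. (\<Sum>j<M. indicator (cell j) t * ?G t))"
      by (simp only: sum_distrib_left[symmetric] Bochner_Integration.integral_sum[OF intj])
    also have "\<dots> \<le> c * (LINT t|lborel. ?G t)"
    proof (intro mult_left_mono integral_mono c Bochner_Integration.integrable_sum intj int)
      fix t
      have "(\<Sum>j<M. indicator (cell j) t) = (indicator (\<Union>j<M. cell j) t :: real)"
        by (rule indicator_UN_disjoint[symmetric]) (auto simp: disjoint_family_on_def disjoint_cells)
      then show "(\<Sum>j<M. indicator (cell j) t * ?G t) \<le> ?G t"
        using nonneg[of "exp t"] by (simp add: sum_distrib_right[symmetric] mult_left_le_one_le indicator_def)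
    qed
    finally show ?thesis .
  qed
  have nn: "0 \<le> \<phi> (node j)" for j by (rule nonneg) simp
  show s: "summable (\<lambda>j. \<phi> (node j))"
    by (rule summableI_nonneg_bounded[OF nn part])
  show "(\<Sum>j. \<phi> (node j)) \<le> c * (LINT t|lborel. ?G t)"
    by (rule suminf_le_const[OF s part])
qed

section \<open>Weighted row sums of the Hilbert matrix\<close>

text \<open>
  Up to a constant, \<open>x^(-3/2)\<close> is the decrement of \<open>x^(-1/2)\<close>; so its tail sums
  telescope.
\<close>

lemma inverse_three_halves_telescope:
  "1 / (node j * sqrt (node j)) \<le> 6 * (1 / sqrt (node j) - 1 / sqrt (node (Suc j)))"
proof -
  define a b where "a = sqrt (node j)" and "b = sqrt (node (Suc j))"
  have ab: "a > 0" "b > 0" "a * a = node j" "b * b = a * a + 1" "1 \<le> 2 * (a * a)"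
    using node_ge_half[of j] by (simp_all add: a_def b_def node_Suc add_pos_pos)
  have "b \<le> 2 * a"
    by (rule power2_le_imp_le) (use ab in \<open>auto simp: power2_eq_square\<close>)
  then have "b * (a + b) \<le> 2 * a * (a + b)" and "2 * a * (a + b) \<le> 2 * a * (3 * a)"
    using ab by (intro mult_right_mono mult_left_mono; simp)+
  then have *: "b * (a + b) \<le> 6 * (a * a)" by simp
  have "b = (b - a) * (b * (a + b))"
    using ab by (simp add: algebra_simps)
  also have "\<dots> \<le> (b - a) * (6 * (a * a))"
    using * ab by (intro mult_left_mono) (auto simp: a_def b_def node_Suc)
  finally have "1 / (a * a * a) \<le> 6 * ((b - a) / (a * b))"
    using ab(1,2) by (simp add: field_simps)
  also have "(b - a) / (a * b) = 1 / a - 1 / b"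
    using ab(1,2) by (simp add: field_simps)
  finally show ?thesis by (simp add: ab(3) flip: a_def b_def)
qed

lemma summable_inverse_three_halves:
  shows "summable (\<lambda>j. 1 / (node (j + N) * sqrt (node (j + N))))"
    and "(\<Sum>j. 1 / (node (j + N) * sqrt (node (j + N)))) \<le> 6 / sqrt (node N)"
proof -
  have part: "(\<Sum>j<M. 1 / (node (j + N) * sqrt (node (j + N)))) \<le> 6 / sqrt (node N)" for M
  proof -
    have "(\<Sum>j<M. 1 / (node (j + N) * sqrt (node (j + N))))
        \<le> (\<Sum>j<M. 6 * (1 / sqrt (node (j + N)) - 1 / sqrt (node (Suc j + N))))"
      using inverse_three_halves_telescope by (intro sum_mono) simp
    also have "\<dots> = 6 * (1 / sqrt (node (0 + N)) - 1 / sqrt (node (M + N)))"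
      using sum_lessThan_telescope'[of "\<lambda>j. 1 / sqrt (node (j + N))" M]
      by (simp only: sum_distrib_left[symmetric])
    also have "\<dots> \<le> 6 / sqrt (node N)" by simp
    finally show ?thesis .
  qed
  show s: "summable (\<lambda>j. 1 / (node (j + N) * sqrt (node (j + N))))"
    by (rule summableI_nonneg_bounded[OF _ part]) simp
  show "(\<Sum>j. 1 / (node (j + N) * sqrt (node (j + N)))) \<le> 6 / sqrt (node N)"
    by (rule suminf_le_const[OF s part])
qed

text \<open>
  Weights \<open>x^(-s)\<close> with \<open>0 < s < 1\<close> are preserved by the Carleman kernel up to a constant. Within a cell the
  variable changes by a factor of at most \<open>3\<close>, hence sum and integral differ by a factor of at most
  \<open>9\<close>. Confining \<open>s\<close> to \<open>[1/4, 3/4]\<close> gives one integrable majorant \<open>exp (- \<bar>u\<bar> / 4)\<close> for all \<open>s\<close>.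
\<close>

lemma hilbert_matrix_powr_sum:
  obtains C where "C > 0"
    "\<And>s n. 1/4 \<le> s \<Longrightarrow> s \<le> 3/4 \<Longrightarrow> summable (\<lambda>j. hilbert_matrix n j * node j powr - s)"
    "\<And>s n. 1/4 \<le> s \<Longrightarrow> s \<le> 3/4 \<Longrightarrow> (\<Sum>j. hilbert_matrix n j * node j powr - s) \<le> C * node n powr - s"
proof -
  define I :: real where "I = (LINT u|lborel. exp (- (1/4 * \<bar>u\<bar>)))"
  have intI: "integrable lborel (\<lambda>u::real. exp (- (1/4 * \<bar>u\<bar>)))"
    by (intro integrable_exp_neg_abs) auto
  have "summable (\<lambda>j. hilbert_matrix n j * node j powr - s)"
       "(\<Sum>j. hilbert_matrix n j * node j powr - s) \<le> (9 * I + 1) * node n powr - s"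
    if s: "1/4 \<le> s" "s \<le> 3/4" for s n
  proof -
    define x where "x = node n"
    have x: "x > 0" by (simp add: x_def)
    define \<phi> where "\<phi> y = y powr - s / (x + y)" for y
    let ?B = "\<lambda>t. x powr - s * exp (- (1/4 * \<bar>- ln x + 1 * t\<bar>))"
    have intB: "integrable lborel ?B"
      by (intro integrable_mult_right lborel_integrable_real_affine[OF intI]) simp
    have B: "exp t * \<phi> (exp t) \<le> ?B t" for t
    proof -
      define u where "u = t - ln x"
      have t: "exp t = x * exp u" using x by (simp add: u_def exp_diff)
      have "exp t powr - s = x powr - s * exp (- s * u)"
        unfolding t using x by (simp add: powr_mult exp_powr_real)
      then have "exp t * \<phi> (exp t) = x powr - s * (exp u * exp (- s * u) / (1 + exp u))"
      proof -
        have "x + x * exp u = x * (1 + exp u)" by (simp add: distrib_left)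
        then show ?thesis
          using x \<open>exp t powr - s = x powr - s * exp (- s * u)\<close> by (simp add: \<phi>_def) (simp add: t)
      qed
      also have "exp u * exp (- s * u) / (1 + exp u) \<le> exp (- (1/4 * \<bar>u\<bar>))"
      proof (cases "u \<ge> 0")
        case True
        have "exp u * exp (- s * u) / (1 + exp u) \<le> exp u * exp (- s * u) / exp u"
          by (intro divide_left_mono) (auto intro!: mult_pos_pos add_pos_pos)
        also have "\<dots> \<le> exp (- (1/4 * \<bar>u\<bar>))"
          using True s mult_right_mono[of "1/4" s u] by simp
        finally show ?thesis .
      next
        case False
        have "exp u * exp (- s * u) / (1 + exp u) \<le> exp u * exp (- s * u) / 1"
          by (intro divide_left_mono) (auto intro!: mult_pos_pos add_pos_pos)
        also have "\<dots> = exp ((1 - s) * u)" by (simp add: exp_add[symmetric] algebra_simps)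
        also have "\<dots> \<le> exp (- (1/4 * \<bar>u\<bar>))"
          using False s mult_right_mono_neg[of "1/4" "1 - s" u] by simp
        finally show ?thesis .
      qed
      finally show ?thesis using x by (simp add: u_def mult_left_mono)
    qed
    have \<phi>_nonneg: "0 \<le> \<phi> y" if "y > 0" for y
      using x that by (simp add: \<phi>_def)
    have [measurable]: "\<phi> \<in> borel_measurable borel" unfolding \<phi>_def by measurable
    have int: "integrable lborel (\<lambda>t. exp t * \<phi> (exp t))"
      by (rule Bochner_Integration.integrable_bound[OF intB], measurable)
         (use B \<phi>_nonneg in \<open>auto intro!: AE_I2 simp: abs_mult\<close>)
    have c: "\<phi> (node j) \<le> 9 * \<phi> (exp t)" if "t \<in> cell j" for j t
    proof -
      define a y where "a = node j" and "y = exp t"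
      have ay: "a > 0" "a \<le> y" "y \<le> 3 * a"
        using that node_ge_half[of j] by (auto simp: cell_iff a_def y_def)
      have "a powr - s = 3 powr s * (3 * a) powr - s"
        using ay by (simp add: powr_mult powr_minus field_simps)
      also have "\<dots> \<le> 3 powr 1 * y powr - s"
        using ay s by (intro mult_mono powr_mono powr_mono2') auto
      finally have "a powr - s \<le> 3 * y powr - s" by simp
      moreover have "x + y \<le> 3 * (x + a)" using x ay by simp
      then have "1 / (x + a) \<le> 3 / (x + y)" using x ay by (simp add: field_simps)
      ultimately have "a powr - s * (1 / (x + a)) \<le> (3 * y powr - s) * (3 / (x + y))"
        using x ay by (intro mult_mono) auto
      then show ?thesis by (simp add: \<phi>_def a_def y_def)
    qed
    note S = node_sum_le_integral[OF int \<phi>_nonneg c]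
    have eq: "hilbert_matrix n j * node j powr - s = 1 / pi * \<phi> (node j)" for j
      by (simp add: hilbert_matrix_node \<phi>_def x_def)
    show "summable (\<lambda>j. hilbert_matrix n j * node j powr - s)"
      unfolding eq by (intro summable_mult S) auto
    have "(LINT t|lborel. exp t * \<phi> (exp t)) \<le> (LINT t|lborel. ?B t)"
      by (intro integral_mono int intB B)
    also have "\<dots> = x powr - s * I"
      using lborel_integral_real_affine[of 1 "\<lambda>u. exp (- (1/4 * \<bar>u\<bar>))" "- ln x"]
      by (simp only: integral_mult_right_zero I_def) simp
    finally have i: "(LINT t|lborel. exp t * \<phi> (exp t)) \<le> x powr - s * I" .
    have nn: "0 \<le> (\<Sum>j. \<phi> (node j))" by (intro suminf_nonneg S \<phi>_nonneg) auto
    have "(\<Sum>j. hilbert_matrix n j * node j powr - s) = 1 / pi * (\<Sum>j. \<phi> (node j))"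
      unfolding eq using S(1) by (intro suminf_mult) auto
    also have "\<dots> \<le> 1 * (\<Sum>j. \<phi> (node j))"
      using pi_ge_two nn by (intro mult_right_mono) auto
    also have "\<dots> \<le> 9 * (x powr - s * I)" using S(2) i by simp
    also have "\<dots> \<le> (9 * I + 1) * x powr - s" by (simp add: algebra_simps)
    finally show "(\<Sum>j. hilbert_matrix n j * node j powr - s) \<le> (9 * I + 1) * node n powr - s"
      by (simp add: x_def)
  qed
  moreover have "9 * I + 1 > 0" unfolding I_def by (intro add_nonneg_pos mult_nonneg_nonneg integral_nonneg_AE) auto
  ultimately show ?thesis using that by blast
qed

section \<open>Iterated Carleman kernels sampled at half-integers\<close>

text \<open>
  The \<open>p\<close>-fold composition of the Carleman kernel \<open>1 / (pi * (x + y))\<close>, sampled at the nodes.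
\<close>

definition hilbert_kernel :: "nat \<Rightarrow> nat \<Rightarrow> nat \<Rightarrow> real" where
  "hilbert_kernel p n m = sech_transform p (ln (node n) - ln (node m)) / (2 * pi * (sqrt (node n) * sqrt (node m)))"

text \<open>
  The identity that turns the Carleman kernel into a convolution in logarithmic variables.
\<close>

lemma sum_eq_cosh:
  fixes x y :: real assumes "x > 0" "y > 0"
  shows "x + y = 2 * (sqrt x * sqrt y) * cosh ((ln x - ln y) / 2)"
proof -
  define a b where "a = sqrt x" and "b = sqrt y"
  have ab: "a > 0" "b > 0" "x = a * a" "y = b * b"
    using assms by (simp_all add: a_def b_def)
  have "(ln x - ln y) / 2 = ln (a / b)"
    using assms by (simp add: a_def b_def ln_div ln_sqrt diff_divide_distrib)
  then have "cosh ((ln x - ln y) / 2) = (a / b + b / a) / 2"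
    using ab by (simp add: cosh_ln_real)
  then show ?thesis
    using ab by (simp add: a_def[symmetric] b_def[symmetric] field_simps)
qed

lemma hilbert_kernel_1: "hilbert_kernel 1 n m = hilbert_matrix n m"
  unfolding hilbert_kernel_def hilbert_matrix_node sech_transform_1 sum_eq_cosh[OF node_pos node_pos] by simp

text \<open>
  The exponential decay of \<open>sech_transform p\<close> in \<open>ln (x / y)\<close>, used in one direction only, becomes a
  separable bound by powers.
\<close>

lemma hilbert_kernel_le:
  assumes "p \<ge> 1"
  obtains C where "C > 0" "\<And>n m. \<bar>hilbert_kernel p n m\<bar> \<le> C * (node n powr (-3/4) * node m powr (-1/4))"
proof -
  obtain D where D: "D > 0" "\<And>t. \<bar>sech_transform p t\<bar> \<le> D * exp (- \<bar>t\<bar> / 4)"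
    using sech_transform_decay[OF assms] by blast
  have "\<bar>hilbert_kernel p n m\<bar> \<le> D * (node n powr (-3/4) * node m powr (-1/4))" for n m
  proof -
    define x y where "x = node n" and "y = node m"
    have xy: "x > 0" "y > 0" by (simp_all add: x_def y_def)
    have "\<bar>sech_transform p (ln x - ln y)\<bar> \<le> D * exp (- (ln x - ln y) / 4)"
      using D(1) by (intro order.trans[OF D(2)] mult_left_mono) auto
    also have "exp (- (ln x - ln y) / 4) = x powr (-1/4) * y powr (1/4)"
      using xy by (simp add: powr_def diff_divide_distrib flip: exp_add)
    finally have "\<bar>sech_transform p (ln x - ln y)\<bar> / (2 * pi) \<le> D * (x powr (-1/4) * y powr (1/4)) / 1"
      using pi_ge_two D(1) by (intro frac_le) auto
    then have "\<bar>sech_transform p (ln x - ln y)\<bar> / (2 * pi) * (1 / (sqrt x * sqrt y)) \<le> D * (x powr (-1/4) * y powr (1/4)) * (1 / (sqrt x * sqrt y))"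
      using xy by (intro mult_right_mono) auto
    also have "\<dots> = D * (x powr (-1/4) * y powr (1/4)) * (x powr (-1/2) * y powr (-1/2))"
      using xy by (simp add: powr_half_sqrt powr_minus divide_simps)
    also have "D * (x powr (-1/4) * y powr (1/4)) * (x powr (-1/2) * y powr (-1/2)) = D * ((x powr (-1/4) * x powr (-1/2)) * (y powr (1/4) * y powr (-1/2)))"
      by (simp only: mult_ac)
    also have "\<dots> = D * (x powr (-3/4) * y powr (-1/4))"
      by (simp flip: powr_add)
    finally show ?thesis
      using xy by (simp add: hilbert_kernel_def x_def y_def abs_mult)
  qed
  then show ?thesis using that D(1) by blast
qed

text \<open>
  The variation over a unit interval of the two factors of the integrand in \<open>hilbert_kernel_step\<close>:
  each loses one power of \<open>a\<close>.
\<close>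

lemma weighted_difference_bound:
  fixes a y x :: real
  assumes "a > 0" "a \<le> y" "y \<le> a + 1" "x > 0"
  shows "1 / (sqrt y * (x + y)) \<le> 1 / (x * sqrt a)"
    and "\<bar>1 / (sqrt a * (x + a)) - 1 / (sqrt y * (x + y))\<bar> \<le> 2 / (x * (a * sqrt a))"
    and "\<bar>ln a - ln y\<bar> \<le> 1 / a"
proof -
  have y: "y > 0" using assms by simp
  show *: "1 / (sqrt y * (x + y)) \<le> 1 / (x * sqrt a)"
    using assms y by (subst mult.commute[of x]) (intro divide_left_mono mult_mono mult_pos_pos; simp)
  define r where "r = a / y"
  have r: "0 < r" "r \<le> 1" "1 - r \<le> 1 / a"
  proof -
    show "0 < r" "r \<le> 1" using assms y by (simp_all add: r_def)
    have "1 - r = (y - a) / y" using y by (simp add: r_def field_simps)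
    also have "\<dots> \<le> 1 / a" using assms y by (intro frac_le) auto
    finally show "1 - r \<le> 1 / a" .
  qed
  have "r * r \<le> sqrt r * ((x + a) / (x + y))"
  proof (rule mult_mono)
    show "r \<le> sqrt r" using r by (intro real_le_rsqrt) (simp add: power2_eq_square mult_left_le)
    show "r \<le> (x + a) / (x + y)" using assms y by (simp add: r_def field_simps)
  qed (use r assms y in auto)
  also have "\<dots> = (1 / (sqrt y * (x + y))) / (1 / (sqrt a * (x + a)))"
    by (simp add: r_def real_sqrt_divide)
  finally have rr: "r * r * (1 / (sqrt a * (x + a))) \<le> 1 / (sqrt y * (x + y))"
    using assms by (subst (asm) pos_le_divide_eq) auto
  have "1 / (sqrt a * (x + a)) - 1 / (sqrt y * (x + y)) \<le> (1 - r * r) * (1 / (sqrt a * (x + a)))"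
    using rr unfolding left_diff_distrib by linarith
  also have "\<dots> \<le> (2 * (1 / a)) * (1 / (x * sqrt a))"
  proof (rule mult_mono)
    have "1 - r * r = (1 + r) * (1 - r)" by (simp add: algebra_simps)
    also have "\<dots> \<le> 2 * (1 / a)" using r by (intro mult_mono) auto
    finally show "1 - r * r \<le> 2 * (1 / a)" .
    show "1 / (sqrt a * (x + a)) \<le> 1 / (x * sqrt a)"
      using assms by (subst mult.commute[of x]) (intro divide_left_mono mult_mono mult_pos_pos; simp)
  qed (use assms in auto)
  finally have u: "1 / (sqrt a * (x + a)) - 1 / (sqrt y * (x + y)) \<le> 2 / (x * (a * sqrt a))"
    by (simp add: mult_ac)
  have "1 / (sqrt y * (x + y)) \<le> 1 / (sqrt a * (x + a))"
    using assms y by (intro divide_left_mono mult_mono mult_pos_pos) auto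
  with u show "\<bar>1 / (sqrt a * (x + a)) - 1 / (sqrt y * (x + y))\<bar> \<le> 2 / (x * (a * sqrt a))"
    by linarith
  have "ln y - ln a = ln (y / a)" using assms y by (simp add: ln_div)
  also have "\<dots> \<le> y / a - 1" using assms y by (intro ln_le_minus_one) auto
  also have "\<dots> = (y - a) / a" using assms by (simp add: diff_divide_distrib)
  also have "\<dots> \<le> 1 / a" using assms by (intro divide_right_mono) auto
  finally have "ln y - ln a \<le> 1 / a" .
  moreover have "ln a \<le> ln y" using assms by (intro ln_mono) auto
  ultimately show "\<bar>ln a - ln y\<bar> \<le> 1 / a" by linarith
qed

text \<open>
  The sum over \<open>j\<close> is a quadrature of the integral that composes the Carleman kernel with its \<open>p\<close>-th
  iterate. The integrand is a Lipschitz function of \<open>ln y\<close> divided by \<open>sqrt y * (x + y)\<close>, so the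
  error in the cell of the node \<open>a\<close> is \<open>O(1 / (x * a^(3/2)))\<close>, and these errors are summable.
\<close>

lemma hilbert_kernel_step:
  assumes p: "p \<ge> 1"
  obtains C where "C > 0" 
    "\<And>n m. summable (\<lambda>j. hilbert_matrix n j * hilbert_kernel p j m)"
    "\<And>n m. \<bar>(\<Sum>j. hilbert_matrix n j * hilbert_kernel p j m) - hilbert_kernel (Suc p) n m\<bar>
        \<le> C * (node n powr (-3/4) * node m powr (-1/2))"
proof -
  define K where "K = sech_transform p 0"
  define L where "L = (LINT x|lborel. \<bar>x\<bar> * (1 / cosh (pi * x)) ^ p)"
  define S where "S = (\<Sum>j. 1 / (node j * sqrt (node j)))"
  define I :: real where "I = (LINT u|lborel. exp (- (1/4 * \<bar>u\<bar>)))"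
  have K: "\<bar>sech_transform p t\<bar> \<le> K" for t using sech_transform_abs_le[OF p] by (simp add: K_def)
  have K0: "K \<ge> 0" using K[of 0] by linarith
  have L: "\<bar>sech_transform p t - sech_transform p s\<bar> \<le> L * \<bar>t - s\<bar>" for t s using sech_transform_lipschitz[OF p] by (simp add: L_def)
  have L0: "L \<ge> 0" using L[of 0 1] by simp
  have sS: "summable (\<lambda>j. 1 / (node j * sqrt (node j)))"
    using summable_inverse_three_halves(1)[of 0] by simp
  have S0: "S \<ge> 0" unfolding S_def by (intro suminf_nonneg sS) simp
  have intI: "integrable lborel (\<lambda>u::real. exp (- (1/4 * \<bar>u\<bar>)))"
    by (intro integrable_exp_neg_abs) auto
  have I0: "I \<ge> 0" unfolding I_def by (intro integral_nonneg_AE) auto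
  define C where "C = 2 * ((2 * K + L) * S + K * I) + 1"
  have C0: "C > 0" unfolding C_def using K0 L0 S0 I0 by (intro add_nonneg_pos mult_nonneg_nonneg add_nonneg_nonneg) auto
  have "summable (\<lambda>j. hilbert_matrix n j * hilbert_kernel p j m) \<and>
     \<bar>(\<Sum>j. hilbert_matrix n j * hilbert_kernel p j m) - hilbert_kernel (Suc p) n m\<bar>
        \<le> C * (node n powr (-3/4) * node m powr (-1/2))" for n m
  proof -
    define x z \<tau> where "x = node n" and "z = node m" and "\<tau> = ln z"
    have xz: "x > 0" "z > 0" by (simp_all add: x_def z_def)
    define \<phi> where "\<phi> y = sech_transform p (ln y - \<tau>) * (1 / (sqrt y * (x + y)))" for y
    have eq: "hilbert_matrix n j * hilbert_kernel p j m = 1 / (2 * pi\<^sup>2 * sqrt z) * \<phi> (node j)" for j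
      by (simp add: hilbert_matrix_node hilbert_kernel_def \<phi>_def x_def z_def \<tau>_def power2_eq_square mult_ac)
    \<comment> \<open>In the variable \<open>t = ln y\<close> the integrand is that of a convolution.\<close>
    have G: "exp t * \<phi> (exp t) = 1 / (2 * sqrt x) * (sech_transform p (- \<tau> + 1 * t) / cosh ((ln x - \<tau> - (- \<tau> + 1 * t)) / 2))" for t
    proof -
      have "x + exp t = 2 * (sqrt x * sqrt (exp t)) * cosh ((ln x - ln (exp t)) / 2)"
        using xz by (intro sum_eq_cosh) auto
      then have "sqrt (exp t) * (x + exp t) = (sqrt (exp t) * sqrt (exp t)) * (2 * sqrt x * cosh ((ln x - t) / 2))"
        by (simp only: ln_exp mult_ac)
      then have "sqrt (exp t) * (x + exp t) = exp t * (2 * sqrt x * cosh ((ln x - t) / 2))"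
        by simp
      then show ?thesis by (simp add: \<phi>_def)
    qed
    have int: "integrable lborel (\<lambda>t. exp t * \<phi> (exp t))"
      unfolding G by (intro integrable_mult_right lborel_integrable_real_affine[OF integrable_sech_transform_conv[OF p]]) simp
    have val: "(LINT t|lborel. exp t * \<phi> (exp t)) = pi * sech_transform (Suc p) (ln x - \<tau>) / sqrt x"
    proof -
      have "(LINT t|lborel. sech_transform p (- \<tau> + 1 * t) / cosh ((ln x - \<tau> - (- \<tau> + 1 * t)) / 2))
          = (LINT s|lborel. sech_transform p s / cosh ((ln x - \<tau> - s) / 2))"
        using lborel_integral_real_affine[of 1 "\<lambda>s. sech_transform p s / cosh ((ln x - \<tau> - s) / 2)" "- \<tau>"] by simp
      also have "\<dots> = 2 * pi * sech_transform (Suc p) (ln x - \<tau>)"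
        using sech_transform_Suc[OF p, of "ln x - \<tau>"] by simp
      finally show ?thesis
        unfolding G integral_mult_right_zero by simp
    qed
    define b where "b j = ((2 * K + L) / x) * (1 / (node j * sqrt (node j)))" for j
    have b: "\<bar>\<phi> (node j) - \<phi> (exp t)\<bar> \<le> b j" if "t \<in> cell j" for j t
    proof -
      define a y where "a = node j" and "y = exp t"
      have ay: "a > 0" "a \<le> y" "y \<le> a + 1" using that by (auto simp: cell_iff a_def y_def)
      note w = weighted_difference_bound[OF ay xz(1)]
      have "\<phi> a - \<phi> y = sech_transform p (ln a - \<tau>) * (1 / (sqrt a * (x + a)) - 1 / (sqrt y * (x + y)))
          + (sech_transform p (ln a - \<tau>) - sech_transform p (ln y - \<tau>)) * (1 / (sqrt y * (x + y)))"
        unfolding \<phi>_def by (simp only: left_diff_distrib right_diff_distrib)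
      then have "\<bar>\<phi> a - \<phi> y\<bar> \<le> \<bar>sech_transform p (ln a - \<tau>)\<bar> * \<bar>1 / (sqrt a * (x + a)) - 1 / (sqrt y * (x + y))\<bar>
          + \<bar>sech_transform p (ln a - \<tau>) - sech_transform p (ln y - \<tau>)\<bar> * \<bar>1 / (sqrt y * (x + y))\<bar>"
        by (simp only: abs_mult[symmetric] abs_triangle_ineq)
      also have "\<dots> \<le> K * (2 / (x * (a * sqrt a))) + (L * (1 / a)) * (1 / (x * sqrt a))"
      proof (intro add_mono mult_mono K w(2))
        have "\<bar>sech_transform p (ln a - \<tau>) - sech_transform p (ln y - \<tau>)\<bar> \<le> L * \<bar>ln a - ln y\<bar>"
          using L[of "ln a - \<tau>" "ln y - \<tau>"] by simp
        also have "\<dots> \<le> L * (1 / a)" by (intro mult_left_mono w L0)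
        finally show "\<bar>sech_transform p (ln a - \<tau>) - sech_transform p (ln y - \<tau>)\<bar> \<le> L * (1 / a)" .
        show "\<bar>1 / (sqrt y * (x + y))\<bar> \<le> 1 / (x * sqrt a)" using w(1) ay xz by simp
      qed (use K0 L0 ay xz in auto)
      also have "\<dots> = b j" by (simp add: b_def a_def add_divide_distrib distrib_right mult_ac)
      finally show ?thesis by (simp add: a_def y_def)
    qed
    have sb: "summable b" unfolding b_def by (intro summable_mult sS)
    have s\<phi>: "summable (\<lambda>j. \<phi> (node j))"
    proof (rule summable_comparison_test)
      show "summable (\<lambda>j. K * (1 / (node j * sqrt (node j))))" by (intro summable_mult sS)
      have "norm (\<phi> (node j)) \<le> K * (1 / (node j * sqrt (node j)))" for j
      proof -
        have "1 / (sqrt (node j) * (x + node j)) \<le> 1 / (node j * sqrt (node j))"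
          using xz by (subst mult.commute) (intro divide_left_mono mult_mono mult_pos_pos; simp add: add_pos_pos)
        then show ?thesis
          unfolding \<phi>_def real_norm_def abs_mult using K0 K xz
          by (intro mult_mono) (auto simp: add_pos_pos abs_of_pos)
      qed
      then show "\<exists>N. \<forall>j\<ge>N. norm (\<phi> (node j)) \<le> K * (1 / (node j * sqrt (node j)))" by blast
    qed
    \<comment> \<open>There is no node below \<open>1/2\<close>; the integral over that range counts as error.\<close>
    have left: "\<bar>LINT t|lborel. indicator {..<ln (1 / 2)} t * (exp t * \<phi> (exp t))\<bar> \<le> K / x * I"
    proof -
      have "\<bar>LINT t|lborel. indicator {..<ln (1 / 2)} t * (exp t * \<phi> (exp t))\<bar>
        \<le> (LINT t|lborel. norm (indicator {..<ln (1 / 2)} t * (exp t * \<phi> (exp t))))"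
        unfolding real_norm_def[symmetric] by (rule integral_norm_bound)
      also have "\<dots> \<le> (LINT t|lborel. K / x * exp (- (1/4 * \<bar>t\<bar>)))"
      proof (intro integral_mono integrable_norm integrable_indicator_times int integrable_mult_right intI)
        fix t :: real
        show "norm (indicator {..<ln (1 / 2)} t * (exp t * \<phi> (exp t))) \<le> K / x * exp (- (1/4 * \<bar>t\<bar>))"
        proof (cases "t < ln (1 / 2)")
          case True
          moreover have "ln (1 / 2 :: real) < 0" by (intro ln_less_zero) auto
          ultimately have t: "t < 0" by linarith
          have e: "exp t = exp (t / 2) * exp (t / 2)" by (simp flip: exp_add)
          have "sqrt (exp t) = exp (t / 2)" unfolding e by simp
          then have "exp t * \<phi> (exp t) = sech_transform p (t - \<tau>) * (exp (t / 2) / (x + exp t))"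
            by (simp add: \<phi>_def) (simp add: e)
          also have "\<bar>\<dots>\<bar> \<le> K * (exp (t / 2) / x)"
            unfolding abs_mult using K xz K0 by (intro mult_mono) (auto intro!: divide_left_mono mult_pos_pos add_pos_pos)
          also have "\<dots> \<le> K * (exp (- (1/4 * \<bar>t\<bar>)) / x)"
            using t xz K0 by (intro mult_left_mono divide_right_mono) auto
          finally show ?thesis using True by (simp add: mult_ac)
        next
          case False
          then show ?thesis using K0 xz by simp
        qed
      qed auto
      also have "\<dots> = K / x * I" by (simp only: integral_mult_right_zero I_def)
      finally show ?thesis .
    qed
    have "\<bar>(\<Sum>j. \<phi> (node j)) - (LINT t|lborel. exp t * \<phi> (exp t))\<bar> \<le> (\<Sum>j. b j) + K / x * I"
      using node_sum_integral_error[OF int b sb s\<phi>] left by linarith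
    also have "(\<Sum>j. b j) = (2 * K + L) / x * S"
      unfolding b_def S_def by (intro suminf_mult sS)
    finally have err: "\<bar>(\<Sum>j. \<phi> (node j)) - (LINT t|lborel. exp t * \<phi> (exp t))\<bar> \<le> ((2 * K + L) * S + K * I) * (1 / x)"
      by (simp add: add_divide_distrib distrib_right)
    define c where "c = 1 / (2 * pi\<^sup>2 * sqrt z)"
    have c: "0 \<le> c" "c \<le> z powr (-1/2)"
    proof -
      have "1 * 1 \<le> 2 * pi\<^sup>2" using pi_ge_two by (intro mult_mono) (auto simp: power2_eq_square intro!: mult_ge1_I)
      then have "1 / (2 * pi\<^sup>2) * (1 / sqrt z) \<le> 1 * (1 / sqrt z)"
        using xz by (intro mult_right_mono) auto
      also have "\<dots> = z powr (-1/2)" using xz by (simp add: powr_half_sqrt powr_minus_divide)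
      finally show "c \<le> z powr (-1/2)" by (simp add: c_def)
      show "0 \<le> c" using xz by (simp add: c_def)
    qed
    \<comment> \<open>The weight \<open>x^(-1)\<close> would pick up a logarithm at the next multiplication; the
      weight \<open>x^(-3/4)\<close> does not, and the diagonal remains summable.\<close>
    have x1: "1 / x \<le> 2 * x powr (-3/4)"
    proof -
      have "1 / x = x powr (-3/4) * x powr (-1/4)"
        using xz by (simp add: powr_minus_divide flip: powr_add)
      also have "x powr (-1/4) \<le> (1/2) powr (-1/4)"
        using xz node_ge_half[of n] by (intro powr_mono2') (auto simp: x_def)
      also have "(1/2) powr (-1/4) \<le> (2::real)"
        using powr_mono[of "1/4" 1 "2::real"] by (simp add: powr_minus powr_divide)
      finally show ?thesis using xz by (simp add: mult_ac)
    qed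
    have H: "(\<Sum>j. hilbert_matrix n j * hilbert_kernel p j m) = c * (\<Sum>j. \<phi> (node j))"
      unfolding eq c_def by (intro suminf_mult s\<phi>)
    have Kx: "hilbert_kernel (Suc p) n m = c * (LINT t|lborel. exp t * \<phi> (exp t))"
      unfolding val by (simp add: hilbert_kernel_def c_def x_def z_def \<tau>_def power2_eq_square)
    have "\<bar>(\<Sum>j. hilbert_matrix n j * hilbert_kernel p j m) - hilbert_kernel (Suc p) n m\<bar>
      = c * \<bar>(\<Sum>j. \<phi> (node j)) - (LINT t|lborel. exp t * \<phi> (exp t))\<bar>"
      unfolding H Kx right_diff_distrib[symmetric] abs_mult using c by simp
    also have "\<dots> \<le> z powr (-1/2) * (((2 * K + L) * S + K * I) * (2 * x powr (-3/4)))"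
    proof (intro mult_mono c order.trans[OF err] mult_left_mono x1)
      show "0 \<le> (2 * K + L) * S + K * I" using K0 L0 S0 I0 by simp
    qed (use err xz in auto)
    also have "\<dots> = (2 * ((2 * K + L) * S + K * I)) * (x powr (-3/4) * z powr (-1/2))"
      by (simp only: mult_ac)
    also have "\<dots> \<le> C * (x powr (-3/4) * z powr (-1/2))"
      by (intro mult_right_mono) (auto simp: C_def)
    finally show ?thesis
      unfolding eq using s\<phi> by (auto simp: x_def z_def eq intro!: summable_mult)
  qed
  then show ?thesis using that C0 by blast
qed

lemma hilbert_matrix_le_powr:
  "hilbert_matrix n l \<le> node n powr (-1/4) * node l powr (-3/4)"
proof -
  define x y where "x = node n" and "y = node l"
  have xy: "x > 0" "y > 0" by (simp_all add: x_def y_def)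
  have "x powr (1/4) * y powr (3/4) \<le> (x + y) powr (1/4) * (x + y) powr (3/4)"
    using xy by (intro mult_mono powr_mono2) auto
  also have "\<dots> = 1 * (x + y)" using xy by (simp flip: powr_add)
  also have "\<dots> \<le> pi * (x + y)" using xy pi_ge_two by (intro mult_right_mono) auto
  finally have "1 / (pi * (x + y)) \<le> 1 / (x powr (1/4) * y powr (3/4))"
    using xy by (intro divide_left_mono mult_pos_pos) auto
  then show ?thesis
    by (simp add: hilbert_matrix_node x_def y_def powr_minus_divide)
qed

text \<open>
  As functions of the summation index both factors are \<open>O(x^(-3/4))\<close>, so the terms beyond \<open>N\<close> sum to
  \<open>O(x_N^(-1/2))\<close>.
\<close>

lemma hilbert_kernel_tail:
  assumes p: "p \<ge> 1"
  obtains C where "C > 0"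
    "\<And>N n m. \<bar>\<Sum>j. hilbert_matrix n (j + N) * hilbert_kernel p (j + N) m\<bar>
       \<le> C * (node n powr (-1/4) * node m powr (-1/4) * node N powr (-1/2))"
proof -
  obtain D where D: "D > 0" "\<And>n m. \<bar>hilbert_kernel p n m\<bar> \<le> D * (node n powr (-3/4) * node m powr (-1/4))"
    using hilbert_kernel_le[OF p] by blast
  have "\<bar>\<Sum>j. hilbert_matrix n (j + N) * hilbert_kernel p (j + N) m\<bar>
       \<le> (6 * D) * (node n powr (-1/4) * node m powr (-1/4) * node N powr (-1/2))" for N n m
  proof -
    define c where "c = D * (node n powr (-1/4) * node m powr (-1/4))"
    have c: "c \<ge> 0" using D by (simp add: c_def)
    have le: "\<bar>hilbert_matrix n (j + N) * hilbert_kernel p (j + N) m\<bar> \<le> c * (1 / (node (j + N) * sqrt (node (j + N))))" for j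
    proof -
      have "\<bar>hilbert_matrix n (j + N) * hilbert_kernel p (j + N) m\<bar>
          \<le> (node n powr (-1/4) * node (j + N) powr (-3/4)) * (D * (node (j + N) powr (-3/4) * node m powr (-1/4)))"
        unfolding abs_mult by (intro mult_mono D) (use hilbert_matrix_le_powr in auto)
      also have "\<dots> = c * (node (j + N) powr (-3/4) * node (j + N) powr (-3/4))"
        by (simp only: c_def mult_ac)
      also have "node (j + N) powr (-3/4) * node (j + N) powr (-3/4) = 1 / (node (j + N) powr (1 + 1/2))"
        by (simp add: powr_minus_divide flip: powr_add)
      finally show ?thesis by (simp only: powr_add) (simp add: powr_half_sqrt)
    qed
    note S = summable_inverse_three_halves[of N]
    have sa: "summable (\<lambda>j. \<bar>hilbert_matrix n (j + N) * hilbert_kernel p (j + N) m\<bar>)"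
      by (rule summable_comparison_test[OF _ summable_mult[OF S(1), of c]]) (use le in auto)
    have "\<bar>\<Sum>j. hilbert_matrix n (j + N) * hilbert_kernel p (j + N) m\<bar>
        \<le> (\<Sum>j. \<bar>hilbert_matrix n (j + N) * hilbert_kernel p (j + N) m\<bar>)"
      by (rule summable_rabs[OF sa])
    also have "\<dots> \<le> (\<Sum>j. c * (1 / (node (j + N) * sqrt (node (j + N)))))"
      by (intro suminf_le le sa summable_mult S)
    also have "\<dots> = c * (\<Sum>j. 1 / (node (j + N) * sqrt (node (j + N))))"
      by (intro suminf_mult S)
    also have "\<dots> \<le> c * (6 / sqrt (node N))" by (intro mult_left_mono S c)
    also have "\<dots> = (6 * D) * (node n powr (-1/4) * node m powr (-1/4) * node N powr (-1/2))"
      by (simp add: c_def powr_minus_divide powr_half_sqrt)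
    finally show ?thesis .
  qed
  then show ?thesis using that[of "6 * D"] D by simp
qed

section \<open>Powers of finite sections\<close>

text \<open>
  The first term has the shape of the quadrature error, the second that of the error from cutting off
  at \<open>N\<close>. In the first index both are powers that the Hilbert matrix reproduces up to a constant, and
  both have bounded sums along the diagonal up to \<open>N\<close>.
\<close>

definition section_error :: "nat \<Rightarrow> nat \<Rightarrow> nat \<Rightarrow> real" where
  "section_error N n m = node n powr (-3/4) * node m powr (-1/2)
     + node n powr (-1/4) * (node m powr (-1/4) * node N powr (-1/2))"

lemma section_error_nonneg [simp]: "0 \<le> section_error N n m"
  by (simp add: section_error_def)

lemma hilbert_matrix_section_error_sum:
  obtains C where "C > 0"
    "\<And>N n m. summable (\<lambda>j. hilbert_matrix n j * section_error N j m)"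
    "\<And>N n m. (\<Sum>j. hilbert_matrix n j * section_error N j m) \<le> C * section_error N n m"
proof -
  obtain C where C: "C > 0"
    "\<And>s n. 1/4 \<le> s \<Longrightarrow> s \<le> 3/4 \<Longrightarrow> summable (\<lambda>j. hilbert_matrix n j * node j powr - s)"
    "\<And>s n. 1/4 \<le> s \<Longrightarrow> s \<le> 3/4 \<Longrightarrow> (\<Sum>j. hilbert_matrix n j * node j powr - s) \<le> C * node n powr - s"
    using hilbert_matrix_powr_sum by blast
  have "summable (\<lambda>j. hilbert_matrix n j * section_error N j m) \<and>
    (\<Sum>j. hilbert_matrix n j * section_error N j m) \<le> C * section_error N n m" for N n m
  proof -
    define u v where "u = node m powr (-1/2)" and "v = node m powr (-1/4) * node N powr (-1/2)"
    have uv: "u \<ge> 0" "v \<ge> 0" by (simp_all add: u_def v_def)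
    have e: "section_error N j m = node j powr - (3/4) * u + node j powr - (1/4) * v" for j
      by (simp add: section_error_def u_def v_def)
    have eq: "hilbert_matrix n j * section_error N j m
        = hilbert_matrix n j * node j powr - (3/4) * u + hilbert_matrix n j * node j powr - (1/4) * v" for j
      unfolding e by (simp only: distrib_left mult.assoc)
    have s: "summable (\<lambda>j. hilbert_matrix n j * node j powr - (3/4) * u)"
      "summable (\<lambda>j. hilbert_matrix n j * node j powr - (1/4) * v)"
      using C(2)[of "3/4" n] C(2)[of "1/4" n] by (auto intro!: summable_mult2)
    have "(\<Sum>j. hilbert_matrix n j * section_error N j m)
        = (\<Sum>j. hilbert_matrix n j * node j powr - (3/4)) * u + (\<Sum>j. hilbert_matrix n j * node j powr - (1/4)) * v"
      unfolding eq using s C(2)[of "3/4" n] C(2)[of "1/4" n] by (simp add: suminf_add[symmetric] suminf_mult2[symmetric])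
    also have "\<dots> \<le> (C * node n powr - (3/4)) * u + (C * node n powr - (1/4)) * v"
      by (intro add_mono mult_right_mono C uv) auto
    also have "\<dots> = C * section_error N n m" unfolding e by (simp add: algebra_simps)
    finally show ?thesis unfolding eq using s by (auto intro: summable_add)
  qed
  then show ?thesis using that C(1) by blast
qed

definition approximates :: "nat \<Rightarrow> real \<Rightarrow> nat \<Rightarrow> (nat \<Rightarrow> nat \<Rightarrow> real) \<Rightarrow> bool" where
  "approximates N C p M \<longleftrightarrow> (\<forall>n m. \<bar>M n m - hilbert_kernel p n m\<bar> \<le> C * section_error N n m)"

text \<open>
  The constant \<open>C\<close> is chosen before \<open>N\<close> and \<open>M\<close>: all later estimates are uniform in \<open>N\<close>. The step is
  stated for the full and for the truncated sum, because powers of a section of the squared matrix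
  alternate between the two.
\<close>

lemma approximation_step:
  assumes p: "p \<ge> 1" and C0: "C0 \<ge> 0"
  shows "\<exists>C\<ge>0. \<forall>N M. approximates N C0 p M \<longrightarrow>
      (\<forall>n m. summable (\<lambda>l. hilbert_matrix n l * M l m)) \<and>
      approximates N C (Suc p) (\<lambda>n m. \<Sum>l. hilbert_matrix n l * M l m) \<and>
      approximates N C (Suc p) (\<lambda>n m. \<Sum>l<N. hilbert_matrix n l * M l m)"
proof -
  obtain C1 where C1: "C1 > 0"
    "\<And>N n m. summable (\<lambda>j. hilbert_matrix n j * section_error N j m)"
    "\<And>N n m. (\<Sum>j. hilbert_matrix n j * section_error N j m) \<le> C1 * section_error N n m"
    using hilbert_matrix_section_error_sum by blast
  obtain C2 where C2: "C2 > 0"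
    "\<And>n m. summable (\<lambda>j. hilbert_matrix n j * hilbert_kernel p j m)"
    "\<And>n m. \<bar>(\<Sum>j. hilbert_matrix n j * hilbert_kernel p j m) - hilbert_kernel (Suc p) n m\<bar>
        \<le> C2 * (node n powr (-3/4) * node m powr (-1/2))"
    using hilbert_kernel_step[OF p] by blast
  obtain C3 where C3: "C3 > 0"
    "\<And>N n m. \<bar>\<Sum>j. hilbert_matrix n (j + N) * hilbert_kernel p (j + N) m\<bar>
       \<le> C3 * (node n powr (-1/4) * node m powr (-1/4) * node N powr (-1/2))"
    using hilbert_kernel_tail[OF p] by blast
  define C where "C = C0 * C1 + C2 + C3"
  have main: "summable (\<lambda>l. hilbert_matrix n l * M l m) \<and>
    \<bar>(\<Sum>l. hilbert_matrix n l * M l m) - hilbert_kernel (Suc p) n m\<bar> \<le> C * section_error N n m \<and>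
    \<bar>(\<Sum>l<N. hilbert_matrix n l * M l m) - hilbert_kernel (Suc p) n m\<bar> \<le> C * section_error N n m"
    if M: "\<And>l m. \<bar>M l m - hilbert_kernel p l m\<bar> \<le> C0 * section_error N l m" for N M n m
  proof -
    let ?H = "hilbert_matrix n" and ?K = "\<lambda>l. hilbert_kernel p l m"
    define d where "d l = ?H l * (M l m - ?K l)" for l
    have d: "\<bar>d l\<bar> \<le> C0 * (?H l * section_error N l m)" for l
      unfolding d_def abs_mult using M[of l m] mult_left_mono[OF M[of l m], of "?H l"] by (simp add: mult_ac)
    have sd: "summable (\<lambda>l. \<bar>d l\<bar>)"
      by (rule summable_comparison_test[OF _ summable_mult[OF C1(2), of C0 n N m]]) (use d in auto)
    have "(\<Sum>l. \<bar>d l\<bar>) \<le> (\<Sum>l. C0 * (?H l * section_error N l m))"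
      by (intro suminf_le d sd summable_mult C1)
    also have "\<dots> = C0 * (\<Sum>l. ?H l * section_error N l m)"
      by (intro suminf_mult C1)
    also have "\<dots> \<le> C0 * (C1 * section_error N n m)"
      by (intro mult_left_mono C1 C0)
    finally have D: "(\<Sum>l. \<bar>d l\<bar>) \<le> C0 * C1 * section_error N n m" by simp
    have "\<bar>\<Sum>l. d l\<bar> \<le> (\<Sum>l. \<bar>d l\<bar>)" by (rule summable_rabs[OF sd])
    with D have D1: "\<bar>\<Sum>l. d l\<bar> \<le> C0 * C1 * section_error N n m" by simp
    have "\<bar>\<Sum>l<N. d l\<bar> \<le> (\<Sum>l<N. \<bar>d l\<bar>)" by (rule sum_abs)
    also have "\<dots> \<le> (\<Sum>l. \<bar>d l\<bar>)" by (intro sum_le_suminf sd) auto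
    finally have D2: "\<bar>\<Sum>l<N. d l\<bar> \<le> C0 * C1 * section_error N n m" using D by simp
    have K1: "\<bar>(\<Sum>j. ?H j * ?K j) - hilbert_kernel (Suc p) n m\<bar> \<le> C2 * section_error N n m"
      using C2(1) by (intro order.trans[OF C2(3)] mult_left_mono) (auto simp: section_error_def)
    have K2: "\<bar>\<Sum>j. ?H (j + N) * ?K (j + N)\<bar> \<le> C3 * section_error N n m"
      using C3(1) by (intro order.trans[OF C3(2)] mult_left_mono) (auto simp: section_error_def)
    have split: "?H l * M l m = ?H l * ?K l + d l" for l by (simp add: d_def algebra_simps)
    have sM: "summable (\<lambda>l. ?H l * M l m)"
      unfolding split by (intro summable_add C2 summable_rabs_cancel[OF sd])
    have e1: "(\<Sum>l. ?H l * M l m) = (\<Sum>l. ?H l * ?K l) + (\<Sum>l. d l)"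
      unfolding split by (intro suminf_add[symmetric] C2 summable_rabs_cancel[OF sd])
    have e2: "(\<Sum>l<N. ?H l * M l m) = (\<Sum>l. ?H l * ?K l) - (\<Sum>j. ?H (j + N) * ?K (j + N)) + (\<Sum>l<N. d l)"
      unfolding split sum.distrib using suminf_minus_initial_segment[OF C2(2)[of n m], of N] by simp
    have "C * section_error N n m = C0 * C1 * section_error N n m + C2 * section_error N n m + C3 * section_error N n m"
      by (simp add: C_def algebra_simps)
    moreover have "0 \<le> C3 * section_error N n m" using C3(1) by simp
    ultimately show ?thesis
      using sM D1 D2 K1 K2 unfolding e1 e2 by (intro conjI) linarith+
  qed
  have "C \<ge> 0" using C0 C1(1) C2(1) C3(1) by (simp add: C_def)
  then show ?thesis using main unfolding approximates_def by (intro exI[of _ C]) blast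
qed

text \<open>
  With \<open>H\<close> for the Hilbert matrix and \<open>E\<close> for the projection to the first \<open>N\<close> coordinates, this is
  the matrix of \<open>(H E H)^k H\<close>; one more factor \<open>H\<close> gives \<open>section_power N k\<close>, the matrix of
  \<open>H^2 E H^2 \<dots> E H^2\<close> with \<open>k + 1\<close> factors \<open>H^2\<close>. Keeping the two factors of each square apart
  reduces everything to multiplication by a single \<open>H\<close>.
\<close>

primrec section_chain :: "nat \<Rightarrow> nat \<Rightarrow> nat \<Rightarrow> nat \<Rightarrow> real" where
  "section_chain N 0 = hilbert_matrix"
| "section_chain N (Suc k) = (\<lambda>n m. \<Sum>l<N. hilbert_matrix n l * (\<Sum>i. hilbert_matrix l i * section_chain N k i m))"

definition section_power :: "nat \<Rightarrow> nat \<Rightarrow> nat \<Rightarrow> nat \<Rightarrow> real" where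
  "section_power N k n m = (\<Sum>i. hilbert_matrix n i * section_chain N k i m)"

lemma section_chain_approx:
  "\<exists>C\<ge>0. \<forall>N. approximates N C (2 * k + 1) (section_chain N k)"
proof (induction k)
  case 0
  show ?case by (intro exI[of _ 0]) (simp add: approximates_def hilbert_kernel_1[simplified])
next
  case (Suc k)
  then obtain C0 where C0: "C0 \<ge> 0" "\<And>N. approximates N C0 (2 * k + 1) (section_chain N k)"
    by blast
  obtain C1 where C1: "C1 \<ge> 0" "\<And>N M. approximates N C0 (2 * k + 1) M \<Longrightarrow>
      approximates N C1 (Suc (2 * k + 1)) (\<lambda>n m. \<Sum>l. hilbert_matrix n l * M l m)"
    using approximation_step[OF _ C0(1), of "2 * k + 1"] by auto
  obtain C2 where C2: "C2 \<ge> 0" "\<And>N M. approximates N C1 (Suc (2 * k + 1)) M \<Longrightarrow>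
      approximates N C2 (Suc (Suc (2 * k + 1))) (\<lambda>n m. \<Sum>l<N. hilbert_matrix n l * M l m)"
    using approximation_step[OF _ C1(1), of "Suc (2 * k + 1)"] by auto
  have "approximates N C2 (2 * Suc k + 1) (section_chain N (Suc k))" for N
    using C2(2)[OF C1(2)[OF C0(2)], of N] by simp
  with C2(1) show ?case by blast
qed

lemma section_power_approx:
  "\<exists>C\<ge>0. \<forall>N. (\<forall>n m. summable (\<lambda>i. hilbert_matrix n i * section_chain N k i m)) \<and>
     approximates N C (2 * k + 2) (section_power N k)"
proof -
  obtain C0 where C0: "C0 \<ge> 0" "\<And>N. approximates N C0 (2 * k + 1) (section_chain N k)"
    using section_chain_approx[of k] by blast
  have p: "1 \<le> 2 * k + 1" by simp
  have e: "2 * k + 2 = Suc (2 * k + 1)" by simp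
  have pow: "section_power N k = (\<lambda>n m. \<Sum>i. hilbert_matrix n i * section_chain N k i m)" for N
    by (intro ext) (simp add: section_power_def)
  obtain C where C: "C \<ge> 0" "\<forall>N M. approximates N C0 (2 * k + 1) M \<longrightarrow>
      (\<forall>n m. summable (\<lambda>l. hilbert_matrix n l * M l m)) \<and>
      approximates N C (Suc (2 * k + 1)) (\<lambda>n m. \<Sum>l. hilbert_matrix n l * M l m) \<and>
      approximates N C (Suc (2 * k + 1)) (\<lambda>n m. \<Sum>l<N. hilbert_matrix n l * M l m)"
    using approximation_step[OF p C0(1)] by (elim exE conjE)
  note mp[OF spec[OF spec[OF C(2)]] C0(2)]
  then show ?thesis
    unfolding e pow using C(1) by (intro exI[of _ C]) simp
qed

section \<open>Trace asymptotics\<close>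

lemma inverse_sqrt_node_sum: "(\<Sum>n<N. 1 / sqrt (node n)) \<le> 3 * sqrt (node N)"
proof -
  have "1 / sqrt (node n) \<le> 3 * (sqrt (node (Suc n)) - sqrt (node n))" for n
  proof -
    define a b where "a = sqrt (node n)" and "b = sqrt (node (Suc n))"
    have ab: "a > 0" "b > 0" "b * b = a * a + 1" "1 \<le> 2 * (a * a)"
      using node_ge_half[of n] by (simp_all add: a_def b_def node_Suc add_pos_pos)
    have "b \<le> 2 * a" by (rule power2_le_imp_le) (use ab in \<open>auto simp: power2_eq_square\<close>)
    moreover have "a \<le> b" by (simp add: a_def b_def node_Suc)
    ultimately have "(b - a) * (b + a) \<le> (b - a) * (3 * a)" using ab by (intro mult_left_mono) auto
    moreover have "(b - a) * (b + a) = 1" using ab by (simp add: algebra_simps)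
    ultimately have "1 \<le> (b - a) * (3 * a)" by simp
    then show ?thesis using ab(1) by (simp add: field_simps flip: a_def b_def)
  qed
  then have "(\<Sum>n<N. 1 / sqrt (node n)) \<le> (\<Sum>n<N. 3 * (sqrt (node (Suc n)) - sqrt (node n)))"
    by (intro sum_mono)
  also have "\<dots> = 3 * (sqrt (node N) - sqrt (node 0))"
    using sum_lessThan_telescope[of "\<lambda>n. sqrt (node n)" N] by (simp only: sum_distrib_left[symmetric])
  also have "\<dots> \<le> 3 * sqrt (node N)" by simp
  finally show ?thesis .
qed

lemma summable_node_powr: "summable (\<lambda>n. node n powr (-5/4))"
proof (rule summable_comparison_test)
  have "summable (\<lambda>n. real n powr (-5/4))" by (simp add: summable_real_powr_iff)
  then have "summable (\<lambda>n. real (Suc n) powr (-5/4))" by (subst summable_Suc_iff)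
  then show "summable (\<lambda>n. (1/2) powr (-5/4) * real (Suc n) powr (-5/4))" by (rule summable_mult)
  have "norm (node n powr (-5/4)) \<le> (1/2) powr (-5/4) * real (Suc n) powr (-5/4)" for n
  proof -
    have "node n powr (-5/4) \<le> (1/2 * real (Suc n)) powr (-5/4)"
      by (intro powr_mono2') (auto simp: node_def)
    then show ?thesis by (simp only: powr_mult) simp
  qed
  then show "\<exists>M. \<forall>n\<ge>M. norm (node n powr (-5/4)) \<le> (1/2) powr (-5/4) * real (Suc n) powr (-5/4)" by blast
qed

text \<open>
  On the diagonal the error terms are \<open>x_n^(-5/4)\<close>, which is summable, and
  \<open>x_n^(-1/2) * x_N^(-1/2)\<close>, whose sum over \<open>n < N\<close> is bounded.
\<close>

lemma section_power_trace:
  obtains B where "\<And>N. \<bar>(\<Sum>n<N. section_power N k n n) - sech_transform (2 * k + 2) 0 / (2 * pi) * (\<Sum>n<N. 1 / node n)\<bar> \<le> B"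
proof -
  obtain C where C: "C \<ge> 0" "\<And>N. approximates N C (2 * k + 2) (section_power N k)"
    using section_power_approx[of k] by blast
  define S where "S = (\<Sum>n. node n powr (-5/4))"
  have "\<bar>(\<Sum>n<N. section_power N k n n) - sech_transform (2 * k + 2) 0 / (2 * pi) * (\<Sum>n<N. 1 / node n)\<bar> \<le> C * (S + 3)" for N
  proof -
    have K: "hilbert_kernel (2 * k + 2) n n = sech_transform (2 * k + 2) 0 / (2 * pi) * (1 / node n)" for n
      by (simp add: hilbert_kernel_def)
    have "(\<Sum>n<N. section_power N k n n) - sech_transform (2 * k + 2) 0 / (2 * pi) * (\<Sum>n<N. 1 / node n)
       = (\<Sum>n<N. section_power N k n n - hilbert_kernel (2 * k + 2) n n)"
      unfolding K sum_subtractf sum_distrib_left ..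
    also have "\<bar>\<dots>\<bar> \<le> (\<Sum>n<N. C * section_error N n n)"
      by (rule sum_abs[THEN order_trans], rule sum_mono) (use C(2)[unfolded approximates_def] in blast)
    also have "\<dots> = C * ((\<Sum>n<N. node n powr (-5/4)) + (\<Sum>n<N. 1 / sqrt (node n)) * (1 / sqrt (node N)))"
    proof -
      have "section_error N n n = node n powr (-5/4) + 1 / sqrt (node n) * (1 / sqrt (node N))" for n
      proof -
        have "node n powr (-1/4) * (node n powr (-1/4) * node N powr (-1/2)) = node n powr (-1/2) * node N powr (-1/2)"
          by (simp add: mult.assoc[symmetric] flip: powr_add)
        moreover have "node n powr (-3/4) * node n powr (-1/2) = node n powr (-5/4)"
          by (simp flip: powr_add)
        ultimately show ?thesis
          unfolding section_error_def by (simp add: powr_minus_divide powr_half_sqrt)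
      qed
      then show ?thesis by (simp only: sum.distrib sum_distrib_left[symmetric] sum_distrib_right[symmetric])
    qed
    also have "\<dots> \<le> C * (S + 3)"
    proof (intro mult_left_mono add_mono C)
      show "(\<Sum>n<N. node n powr (-5/4)) \<le> S"
        unfolding S_def by (intro sum_le_suminf summable_node_powr) auto
      have "(\<Sum>n<N. 1 / sqrt (node n)) * (1 / sqrt (node N)) \<le> (3 * sqrt (node N)) * (1 / sqrt (node N))"
        by (intro mult_right_mono inverse_sqrt_node_sum) simp
      then show "(\<Sum>n<N. 1 / sqrt (node n)) * (1 / sqrt (node N)) \<le> 3" by simp
    qed
    finally show ?thesis .
  qed
  then show ?thesis using that by blast
qed

text \<open>
  The increments of \<open>ln x_n\<close> lie between \<open>1 / x_(n+1)\<close> and \<open>1 / x_n\<close>, and the difference of the two bounds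
  telescopes.
\<close>

lemma inverse_node_sum_asymp: "(\<lambda>N. (\<Sum>n<N. 1 / node n) / ln (real N)) \<longlonglongrightarrow> 1"
proof -
  have bounds: "0 \<le> (\<Sum>n<N. 1 / node n) - (ln (node N) - ln (node 0))"
    "(\<Sum>n<N. 1 / node n) - (ln (node N) - ln (node 0)) \<le> 2" for N
  proof -
    have l: "ln (node (Suc n)) - ln (node n) \<le> 1 / node n" "1 / node (Suc n) \<le> ln (node (Suc n)) - ln (node n)" for n
    proof -
      have "ln (node (Suc n) / node n) \<le> node (Suc n) / node n - 1" by (intro ln_le_minus_one) auto
      also have "\<dots> = 1 / node n" by (simp add: node_Suc add_divide_distrib)
      finally show "ln (node (Suc n)) - ln (node n) \<le> 1 / node n" by (simp add: ln_div)
      have "ln (node n / node (Suc n)) \<le> node n / node (Suc n) - 1" by (intro ln_le_minus_one) auto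
      also have "\<dots> = - 1 / node (Suc n)" 
      proof -
        have "node n = node (Suc n) - 1" by (simp add: node_Suc)
        then show ?thesis by (simp add: diff_divide_distrib)
      qed
      finally show "1 / node (Suc n) \<le> ln (node (Suc n)) - ln (node n)" by (simp add: ln_div)
    qed
    have t: "ln (node N) - ln (node 0) = (\<Sum>n<N. ln (node (Suc n)) - ln (node n))"
      using sum_lessThan_telescope[of "\<lambda>n. ln (node n)" N] by simp
    show "0 \<le> (\<Sum>n<N. 1 / node n) - (ln (node N) - ln (node 0))"
      unfolding t sum_subtractf[symmetric] using l(1) by (intro sum_nonneg) simp
    have "(\<Sum>n<N. 1 / node n) - (ln (node N) - ln (node 0)) \<le> (\<Sum>n<N. 1 / node n - 1 / node (Suc n))"
      unfolding t sum_subtractf[symmetric] by (intro sum_mono diff_left_mono l)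
    also have "\<dots> = 1 / node 0 - 1 / node N" by (rule sum_lessThan_telescope')
    also have "\<dots> \<le> 2" by (simp add: node_def)
    finally show "(\<Sum>n<N. 1 / node n) - (ln (node N) - ln (node 0)) \<le> 2" .
  qed
  show ?thesis
  proof (rule tendsto_sandwich)
    have "eventually (\<lambda>N::nat. ln (real N) > 0) sequentially" by real_asymp
    then show "eventually (\<lambda>N. (ln (real N + 1 / 2) - ln (1 / 2)) / ln (real N) \<le> (\<Sum>n<N. 1 / node n) / ln (real N)) sequentially"
      by eventually_elim (use bounds(1) in \<open>auto intro!: divide_right_mono simp: node_def\<close>)
    have "eventually (\<lambda>N::nat. ln (real N) > 0) sequentially" by real_asymp
    then show "eventually (\<lambda>N. (\<Sum>n<N. 1 / node n) / ln (real N) \<le> (ln (real N + 1 / 2) - ln (1 / 2) + 2) / ln (real N)) sequentially"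
    proof eventually_elim
      case (elim N)
      have "(\<Sum>n<N. 1 / node n) \<le> ln (real N + 1 / 2) - ln (1 / 2) + 2"
        using bounds(2)[of N] by (simp only: node_def of_nat_0 add_0)
      then show ?case using elim by (intro divide_right_mono) auto
    qed
    show "(\<lambda>N. (ln (real N + 1 / 2) - ln (1 / 2)) / ln (real N)) \<longlonglongrightarrow> 1" by real_asymp
    show "(\<lambda>N. (ln (real N + 1 / 2) - ln (1 / 2) + 2) / ln (real N)) \<longlonglongrightarrow> 1" by real_asymp
  qed
qed

lemma section_power_trace_asymp:
  "(\<lambda>N. (\<Sum>n<N. section_power N k n n) / ln (real N)) \<longlonglongrightarrow> sech_transform (2 * k + 2) 0 / (2 * pi)"
proof -
  define c where "c = sech_transform (2 * k + 2) 0 / (2 * pi)"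
  obtain B where B: "\<And>N. \<bar>(\<Sum>n<N. section_power N k n n) - c * (\<Sum>n<N. 1 / node n)\<bar> \<le> B"
    using section_power_trace[of k] unfolding c_def by blast
  have "(\<lambda>N. ((\<Sum>n<N. section_power N k n n) - c * (\<Sum>n<N. 1 / node n)) / ln (real N)) \<longlonglongrightarrow> 0"
  proof (rule Lim_null_comparison)
    show "(\<lambda>N. B / ln (real N)) \<longlonglongrightarrow> 0" by real_asymp
    have "eventually (\<lambda>N::nat. ln (real N) > 0) sequentially" by real_asymp
    then show "eventually (\<lambda>N. norm (((\<Sum>n<N. section_power N k n n) - c * (\<Sum>n<N. 1 / node n)) / ln (real N)) \<le> B / ln (real N)) sequentially"
      by eventually_elim (use B in \<open>auto intro!: divide_right_mono\<close>)
  qed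
  from tendsto_add[OF this tendsto_mult[OF tendsto_const[of c] inverse_node_sum_asymp]]
  show ?thesis by (simp add: c_def diff_divide_distrib)
qed

section \<open>The sharp weighted bound for the Hilbert matrix\<close>

text \<open>
  The midpoint rule underestimates the integral of a convex function. The right-hand side is the
  integral of \<open>1 / (sqrt y * (x + y))\<close> over the unit interval centred at \<open>c\<close>.
\<close>

lemma inverse_sqrt_quadrature:
  fixes x c :: real
  assumes x: "x > 0" and c: "c \<ge> 1 / 2"
  shows "1 / (sqrt c * (x + c)) \<le> 2 / sqrt x * arctan (sqrt (c + 1/2) / sqrt x) - 2 / sqrt x * arctan (sqrt (c - 1/2) / sqrt x)"
proof -
  define \<Phi> where "\<Phi> y = 2 / sqrt x * arctan (sqrt y / sqrt x)" for y
  define g where "g y = 1 / (sqrt y * (x + y))" for y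
  have D: "(\<Phi> has_real_derivative g y) (at y)" if y: "y > 0" for y
  proof -
    have "(\<Phi> has_real_derivative 2 / sqrt x * (inverse (1 + (sqrt y / sqrt x)\<^sup>2) * ((inverse (sqrt y) / 2) / sqrt x))) (at y)"
      unfolding \<Phi>_def
      by (intro DERIV_cmult DERIV_chain2[OF DERIV_arctan] DERIV_cdivide DERIV_real_sqrt[THEN DERIV_cong] y) simp
    also have "2 / sqrt x * (inverse (1 + (sqrt y / sqrt x)\<^sup>2) * ((inverse (sqrt y) / 2) / sqrt x)) = g y"
    proof -
      define a where "a = sqrt x"
      have a: "a > 0" "x = a * a" using x by (simp_all add: a_def)
      have "(sqrt y / sqrt x)\<^sup>2 = y / x" using x y by (simp add: power_divide)
      then have "inverse (1 + (sqrt y / sqrt x)\<^sup>2) = x / (x + y)" using x y by (simp add: field_simps)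
      then show ?thesis unfolding g_def a_def[symmetric] using a y by (simp add: inverse_eq_divide)
    qed
    finally show ?thesis .
  qed
  \<comment> \<open>By the inequality of the means it suffices to compare the product of the outer values with the
    square of the middle one.\<close>
  have g: "2 * g c \<le> g (c + u) + g (c - u)" if u: "0 < u" "u < 1/2" for u
  proof -
    define A B where "A = c + u" and "B = c - u"
    have AB: "A > 0" "B > 0" using u c by (simp_all add: A_def B_def)
    have "sqrt A * sqrt B \<le> c"
      unfolding real_sqrt_mult[symmetric] using c by (intro real_le_lsqrt) (auto simp: A_def B_def power2_eq_square algebra_simps)
    moreover have "(x + A) * (x + B) \<le> (x + c) * (x + c)"
      by (simp add: A_def B_def algebra_simps)
    ultimately have "(sqrt A * sqrt B) * ((x + A) * (x + B)) \<le> c * ((x + c) * (x + c))"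
      by (rule mult_mono) (use AB x c in auto)
    then have "1 / (c * ((x + c) * (x + c))) \<le> 1 / ((sqrt A * sqrt B) * ((x + A) * (x + B)))"
      using AB x c by (intro divide_left_mono mult_pos_pos) auto
    also have "\<dots> = g A * g B" by (simp add: g_def)
    finally have le: "1 / (c * ((x + c) * (x + c))) \<le> g A * g B" .
    have "(sqrt c * (x + c)) * (sqrt c * (x + c)) = (sqrt c * sqrt c) * ((x + c) * (x + c))"
      by (simp only: mult_ac)
    also have "sqrt c * sqrt c = c" using c by simp
    finally have "g c * g c = 1 / (c * ((x + c) * (x + c)))"
      by (simp only: g_def times_divide_times_eq mult_1_right)
    with le have *: "g c * g c \<le> g A * g B" by simp
    have "(2 * g c)\<^sup>2 \<le> 4 * (g A * g B)" using * by (simp add: power2_eq_square)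
    also have "\<dots> = (g A + g B)\<^sup>2 - (g A - g B)\<^sup>2" by (simp add: power2_eq_square algebra_simps)
    also have "\<dots> \<le> (g A + g B)\<^sup>2" by simp
    finally show ?thesis unfolding A_def[symmetric] B_def[symmetric]
      by (rule power2_le_imp_le) (use AB x in \<open>simp add: g_def\<close>)
  qed
  let ?h = "\<lambda>u. \<Phi> (c + u) - \<Phi> (c - u) - 2 * u * g c"
  have "?h 0 \<le> ?h (1/2)"
  proof (rule DERIV_nonneg_imp_increasing_open[of 0 "1/2" ?h])
    fix u :: real assume u: "0 < u" "u < 1/2"
    have "(?h has_real_derivative (g (c + u) * 1 - g (c - u) * (-1) - 2 * g c)) (at u)"
      using u c by (auto intro!: derivative_eq_intros DERIV_chain2[OF D])
    then show "\<exists>y. (?h has_real_derivative y) (at u) \<and> 0 \<le> y"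
      using g[OF u] by (intro exI conjI) auto
  next
    show "continuous_on {0..1/2} ?h"
      unfolding \<Phi>_def by (intro continuous_intros) (use x in auto)
  qed auto
  then show ?thesis by (simp add: \<Phi>_def g_def)
qed

text \<open>
  The positive generalised eigenfunction \<open>x^(-1/2)\<close> of the Carleman kernel at the top \<open>1\<close> of its
  spectrum, sampled at the nodes.
\<close>

definition weight :: "nat \<Rightarrow> real" where "weight n = 1 / sqrt (node n)"

lemma weight_pos [simp]: "weight n > 0" and weight_nonneg [simp]: "weight n \<ge> 0"
  by (simp_all add: weight_def)

text \<open>
  The constant \<open>1\<close> is essential here: bounds on all powers, uniform in the exponent, follow by
  iteration. It is attained by the integral of \<open>1 / (sqrt y * (x + y))\<close> over the half-line, which is
  \<open>pi / sqrt x\<close>, and the midpoint rule stays below it.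
\<close>

lemma hilbert_matrix_weight_sum:
  "summable (\<lambda>j. hilbert_matrix n j * weight j)" "(\<Sum>j. hilbert_matrix n j * weight j) \<le> weight n"
proof -
  define x where "x = node n"
  have x: "x > 0" by (simp add: x_def)
  define F where "F j = 2 / sqrt x * arctan (sqrt (real j) / sqrt x)" for j
  have le: "hilbert_matrix n j * weight j \<le> 1 / pi * (F (Suc j) - F j)" for j
  proof -
    have "1 / (sqrt (node j) * (x + node j)) \<le> F (Suc j) - F j"
      using inverse_sqrt_quadrature[OF x, of "node j"] by (simp add: node_def F_def add.commute)
    then have "1 / pi * (1 / (sqrt (node j) * (x + node j))) \<le> 1 / pi * (F (Suc j) - F j)"
      by (intro mult_left_mono) auto
    then show ?thesis by (simp add: hilbert_matrix_node weight_def x_def mult_ac)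
  qed
  have part: "(\<Sum>j<M. hilbert_matrix n j * weight j) \<le> weight n" for M
  proof -
    have "(\<Sum>j<M. hilbert_matrix n j * weight j) \<le> (\<Sum>j<M. 1 / pi * (F (Suc j) - F j))"
      by (intro sum_mono le)
    also have "\<dots> = 1 / pi * (F M - F 0)"
      using sum_lessThan_telescope[of F M] by (simp only: sum_distrib_left[symmetric])
    also have "F 0 = 0" by (simp add: F_def)
    also have "1 / pi * (F M - 0) \<le> 1 / pi * (2 / sqrt x * (pi / 2) - 0)"
      unfolding F_def using arctan_ubound[of "sqrt (real M) / sqrt x"] x
      by (intro mult_left_mono diff_mono) auto
    also have "\<dots> = weight n" by (simp add: weight_def x_def)
    finally show ?thesis .
  qed
  show s: "summable (\<lambda>j. hilbert_matrix n j * weight j)"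
    by (rule summableI_nonneg_bounded[OF _ part]) simp
  show "(\<Sum>j. hilbert_matrix n j * weight j) \<le> weight n"
    by (rule suminf_le_const[OF s part])
qed

lemma hilbert_matrix_le_weight: "hilbert_matrix n m \<le> weight n * weight m / (2 * pi)"
proof -
  have "2 * (sqrt (node n) * sqrt (node m)) \<le> node n + node m"
    using sum_squares_bound[of "sqrt (node n)" "sqrt (node m)"] by simp
  then have "pi * (2 * (sqrt (node n) * sqrt (node m))) \<le> pi * (node n + node m)" by simp
  then have "1 / (pi * (node n + node m)) \<le> 1 / (pi * (2 * (sqrt (node n) * sqrt (node m))))"
    by (intro divide_left_mono mult_pos_pos) (auto simp: add_pos_pos)
  then show ?thesis by (simp add: hilbert_matrix_node weight_def mult_ac)
qed

lemma summable_section_power: "summable (\<lambda>i. hilbert_matrix n i * section_chain N k i m)"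
  using section_power_approx[of k] by blast

text \<open>
  Starting from \<open>hilbert_matrix_le_weight\<close>, every further factor acts on the first index only and does
  not increase the weight. The bound is the same for all \<open>k\<close>, which is what allows the limit to be taken
  termwise in the logarithm series.
\<close>

lemma section_bounds:
  "0 \<le> section_chain N k n m \<and> section_chain N k n m \<le> weight n * weight m / (2 * pi)"
  "0 \<le> section_power N k n m \<and> section_power N k n m \<le> weight n * weight m / (2 * pi)"
proof -
  have full: "0 \<le> (\<Sum>i. hilbert_matrix n i * f i) \<and> (\<Sum>i. hilbert_matrix n i * f i) \<le> weight n * c"
    if f: "\<And>i. 0 \<le> f i" "\<And>i. f i \<le> weight i * c" "c \<ge> 0" "summable (\<lambda>i. hilbert_matrix n i * f i)" for f c n
  proof
    show "0 \<le> (\<Sum>i. hilbert_matrix n i * f i)" using f by (intro suminf_nonneg) auto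
    have le: "hilbert_matrix n i * f i \<le> hilbert_matrix n i * weight i * c" for i
      using mult_left_mono[OF f(2)[of i], of "hilbert_matrix n i"] by (simp add: mult.assoc)
    have "(\<Sum>i. hilbert_matrix n i * f i) \<le> (\<Sum>i. hilbert_matrix n i * weight i * c)"
      by (intro suminf_le le f summable_mult2 hilbert_matrix_weight_sum)
    also have "\<dots> = (\<Sum>i. hilbert_matrix n i * weight i) * c"
      by (intro suminf_mult2[symmetric] hilbert_matrix_weight_sum)
    also have "\<dots> \<le> weight n * c" by (intro mult_right_mono hilbert_matrix_weight_sum f)
    finally show "(\<Sum>i. hilbert_matrix n i * f i) \<le> weight n * c" .
  qed
  have power: "0 \<le> section_power N k n m \<and> section_power N k n m \<le> weight n * weight m / (2 * pi)"
    if "\<And>n. 0 \<le> section_chain N k n m \<and> section_chain N k n m \<le> weight n * weight m / (2 * pi)" for k n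
    using full[of "\<lambda>i. section_chain N k i m" "weight m / (2 * pi)" n] that summable_section_power[of n N k m]
    by (simp add: section_power_def)
  have chain: "0 \<le> section_chain N k n m \<and> section_chain N k n m \<le> weight n * weight m / (2 * pi)" for n
  proof (induction k arbitrary: n)
    case 0
    show ?case by (simp add: hilbert_matrix_le_weight)
  next
    case (Suc k)
    have P: "0 \<le> section_power N k l m \<and> section_power N k l m \<le> weight l * weight m / (2 * pi)" for l
      using power[OF Suc] .
    have e: "section_chain N (Suc k) n m = (\<Sum>l<N. hilbert_matrix n l * section_power N k l m)"
      by (simp add: section_power_def)
    have "(\<Sum>l<N. hilbert_matrix n l * section_power N k l m) \<le> (\<Sum>l<N. (hilbert_matrix n l * weight l) * (weight m / (2 * pi)))"
      using mult_left_mono[OF conjunct2[OF P], of "hilbert_matrix n _"]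
      by (intro sum_mono) (simp add: mult.assoc)
    also have "\<dots> = (\<Sum>l<N. hilbert_matrix n l * weight l) * (weight m / (2 * pi))"
      by (simp only: sum_distrib_right)
    also have "\<dots> \<le> weight n * (weight m / (2 * pi))"
      using sum_le_suminf[OF hilbert_matrix_weight_sum(1)[of n], of "{..<N}"] hilbert_matrix_weight_sum(2)[of n]
      by (intro mult_right_mono) auto
    finally show ?case unfolding e using P by (auto intro!: sum_nonneg)
  qed
  show "0 \<le> section_chain N k n m \<and> section_chain N k n m \<le> weight n * weight m / (2 * pi)"
    by (rule chain)
  show "0 \<le> section_power N k n m \<and> section_power N k n m \<le> weight n * weight m / (2 * pi)"
    by (rule power[OF chain])
qed

section \<open>Determinants as exponentials of traces\<close>

lemma trace_mult_commute:
  fixes A B :: "'a :: comm_semiring_0 mat"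
  assumes "A \<in> carrier_mat n n" "B \<in> carrier_mat n n"
  shows "(\<Sum>i<n. (A * B) $$ (i, i)) = (\<Sum>i<n. (B * A) $$ (i, i))"
proof -
  have "(\<Sum>i<n. (A * B) $$ (i, i)) = (\<Sum>i<n. \<Sum>j<n. A $$ (i, j) * B $$ (j, i))"
    using assms by (simp add: scalar_prod_def lessThan_atLeast0)
  also have "\<dots> = (\<Sum>j<n. \<Sum>i<n. B $$ (j, i) * A $$ (i, j))"
    by (subst sum.swap) (simp add: mult.commute)
  also have "\<dots> = (\<Sum>i<n. (B * A) $$ (i, i))"
    using assms by (simp add: scalar_prod_def lessThan_atLeast0)
  finally show ?thesis .
qed

lemma upper_triangular_pow_mat:
  fixes B :: "'a :: comm_ring_1 mat"
  assumes B: "B \<in> carrier_mat n n" "upper_triangular B"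
  shows "upper_triangular (B ^\<^sub>m k) \<and> (\<forall>i<n. (B ^\<^sub>m k) $$ (i, i) = (B $$ (i, i)) ^ k)"
proof (induction k)
  case 0
  show ?case using B by (auto simp: upper_triangular_def)
next
  case (Suc k)
  let ?M = "B ^\<^sub>m k"
  have M: "?M \<in> carrier_mat n n" using B by simp
  have entry: "(?M * B) $$ (i, j) = (\<Sum>l<n. ?M $$ (i, l) * B $$ (l, j))" if "i < n" "j < n" for i j
    using that B M by (simp add: scalar_prod_def lessThan_atLeast0)
  have z: "?M $$ (i, j) = 0" "B $$ (i, j) = 0" if "j < i" "i < n" for i j
    using Suc B M that by (auto simp: upper_triangular_def)
  have "(?M * B) $$ (i, j) = 0" if "j < i" "i < n" for i j
    unfolding entry[OF \<open>i < n\<close> less_trans[OF that]]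
  proof (rule sum.neutral, rule ballI)
    fix l assume "l \<in> {..<n}"
    then show "?M $$ (i, l) * B $$ (l, j) = 0"
      using z[of l i] z[of j l] that by (cases "l < i") auto
  qed
  moreover have "(?M * B) $$ (i, i) = (B $$ (i, i)) ^ Suc k" if "i < n" for i
  proof -
    have "(?M * B) $$ (i, i) = (\<Sum>l<n. if l = i then ?M $$ (i, i) * B $$ (i, i) else 0)"
      unfolding entry[OF that that]
    proof (rule sum.cong[OF refl])
      fix l assume "l \<in> {..<n}"
      then show "?M $$ (i, l) * B $$ (l, i) = (if l = i then ?M $$ (i, i) * B $$ (i, i) else 0)"
        using z[of l i] z[of i l] that by (cases l i rule: linorder_cases) auto
    qed
    then show ?thesis using that Suc by (simp add: mult.commute)
  qed
  ultimately show ?case using B M by (auto simp: upper_triangular_def)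
qed

text \<open>
  The eigenvalues with multiplicity, read off the diagonal of a Schur triangularisation. Traces of
  powers and the determinant are invariant under similarity.
\<close>

lemma complex_mat_eigenvalue_list:
  fixes A :: "complex mat"
  assumes A: "A \<in> carrier_mat n n"
  obtains e where "\<And>i. i < n \<Longrightarrow> eigenvalue A (e i)"
    "\<And>k. (\<Sum>i<n. (A ^\<^sub>m k) $$ (i, i)) = (\<Sum>i<n. e i ^ k)"
    "\<And>z. Determinant.det (1\<^sub>m n - z \<cdot>\<^sub>m A) = (\<Prod>i<n. 1 - z * e i)"
proof -
  obtain es where es: "char_poly A = (\<Prod>a\<leftarrow>es. [:- a, 1:])" "length es = n"
    using char_poly_factorized[OF A] by blast
  obtain B P Q where "schur_decomposition A es = (B, P, Q)" by (metis prod_cases3)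
  from schur_decomposition[OF A es(1) this]
  have wit: "similar_mat_wit A B P Q" and ut: "upper_triangular B" and diag: "diag_mat B = es" by auto
  from similar_mat_witD2[OF A wit]
  have PQ: "P * Q = 1\<^sub>m n" "Q * P = 1\<^sub>m n" and APBQ: "A = P * B * Q"
    and B: "B \<in> carrier_mat n n" and P: "P \<in> carrier_mat n n" and Q: "Q \<in> carrier_mat n n" by auto
  define e where "e i = es ! i" for i
  have e: "B $$ (i, i) = e i" if "i < n" for i
    using that B by (simp add: e_def flip: diag) (simp add: diag_mat_def)
  show ?thesis
  proof (rule that[of e])
    fix i assume "i < n"
    then have "e i \<in> set es" by (simp add: e_def es)
    then have "poly (char_poly A) (e i) = 0"
      unfolding es(1) poly_prod_list by (induction es) auto
    then show "eigenvalue A (e i)" by (simp add: eigenvalue_root_char_poly[OF A])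
  next
    fix k
    have Bk: "B ^\<^sub>m k \<in> carrier_mat n n" using B by simp
    have "(\<Sum>i<n. (A ^\<^sub>m k) $$ (i, i)) = (\<Sum>i<n. (P * B ^\<^sub>m k * Q) $$ (i, i))"
      by (simp only: similar_mat_wit_pow_id[OF wit])
    also have "\<dots> = (\<Sum>i<n. (Q * (P * B ^\<^sub>m k)) $$ (i, i))"
      by (rule trace_mult_commute) (use P Q Bk in auto)
    also have "Q * (P * B ^\<^sub>m k) = B ^\<^sub>m k"
      using P Q Bk PQ by (simp add: left_mult_one_mat[OF Bk] flip: assoc_mult_mat[of _ n n _ n _ n])
    also have "(\<Sum>i<n. (B ^\<^sub>m k) $$ (i, i)) = (\<Sum>i<n. e i ^ k)"
      using upper_triangular_pow_mat[OF B ut, of k] e by simp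
    finally show "(\<Sum>i<n. (A ^\<^sub>m k) $$ (i, i)) = (\<Sum>i<n. e i ^ k)" .
  next
    fix z :: complex
    let ?C = "1\<^sub>m n - z \<cdot>\<^sub>m B"
    have C: "?C \<in> carrier_mat n n" using B by (intro minus_carrier_mat smult_carrier_mat)
    have "P * ?C * Q = (P * 1\<^sub>m n - P * (z \<cdot>\<^sub>m B)) * Q"
      using P B by (simp add: mult_minus_distrib_mat[of _ n n _ n])
    also have "\<dots> = P * 1\<^sub>m n * Q - P * (z \<cdot>\<^sub>m B) * Q"
      using P B Q by (intro minus_mult_distrib_mat[of _ n n]) auto
    also have "\<dots> = 1\<^sub>m n - z \<cdot>\<^sub>m A"
      using P B Q PQ by (simp add: APBQ mult_smult_distrib[of _ n n _ n] mult_smult_assoc_mat[of _ n n _ n])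
    finally have "similar_mat_wit (1\<^sub>m n - z \<cdot>\<^sub>m A) ?C P Q"
      using A C P Q PQ by (intro similar_mat_witI[of _ _ n]) auto
    then have "Determinant.det (1\<^sub>m n - z \<cdot>\<^sub>m A) = Determinant.det ?C"
      by (intro det_similar) (auto simp: similar_mat_def)
    also have "\<dots> = prod_list (diag_mat ?C)"
      using ut B by (intro det_upper_triangular[OF _ C]) (auto simp: upper_triangular_def)
    also have "diag_mat ?C = map (\<lambda>i. 1 - z * e i) [0..<n]"
      using B e by (auto simp: diag_mat_def)
    also have "prod_list \<dots> = (\<Prod>i<n. 1 - z * e i)"
      by (simp add: prod.distinct_set_conv_list[symmetric] lessThan_atLeast0)
    finally show "Determinant.det (1\<^sub>m n - z \<cdot>\<^sub>m A) = (\<Prod>i<n. 1 - z * e i)" .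
  qed
qed

text \<open>
  The maximum principle: compare both sides of the eigenvalue equation in the coordinate where
  the eigenvector is largest relative to the weight.
\<close>

lemma eigenvalue_norm_le_1:
  fixes A :: "complex mat" and w :: "nat \<Rightarrow> real"
  assumes A: "A \<in> carrier_mat n n" and w: "\<And>i. w i > 0"
    and row: "\<And>i. i < n \<Longrightarrow> (\<Sum>j<n. norm (A $$ (i, j)) * w j) \<le> w i"
    and ev: "eigenvalue A e"
  shows "norm e \<le> 1"
proof -
  obtain v where v: "v \<in> carrier_vec n" "v \<noteq> 0\<^sub>v n" "A *\<^sub>v v = e \<cdot>\<^sub>v v"
    using ev A by (auto simp: eigenvalue_def eigenvector_def)
  have "\<exists>j<n. v $ j \<noteq> 0"
    using v by (metis carrier_vecD eq_vecI index_zero_vec)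
  then obtain j0 where j0: "j0 < n" "v $ j0 \<noteq> 0" by blast
  define r where "r = Max ((\<lambda>j. norm (v $ j) / w j) ` {..<n})"
  have le: "norm (v $ j) / w j \<le> r" if "j < n" for j
    unfolding r_def using that by (intro Max_ge) auto
  have "r \<in> (\<lambda>j. norm (v $ j) / w j) ` {..<n}"
    unfolding r_def using j0 by (intro Max_in) auto
  then obtain i where i: "i < n" "r = norm (v $ i) / w i" by auto
  have "0 < norm (v $ j0) / w j0" using j0 w by simp
  with le[OF j0(1)] have r: "r > 0" by linarith
  have "norm e * norm (v $ i) = norm ((A *\<^sub>v v) $ i)"
    using v i by (simp add: norm_mult)
  also have "(A *\<^sub>v v) $ i = (\<Sum>j<n. A $$ (i, j) * v $ j)"
    using A v(1) i by (simp add: scalar_prod_def lessThan_atLeast0)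
  also have "norm \<dots> \<le> (\<Sum>j<n. norm (A $$ (i, j)) * norm (v $ j))"
    by (rule order.trans[OF norm_sum]) (simp add: norm_mult)
  also have "\<dots> \<le> (\<Sum>j<n. (norm (A $$ (i, j)) * w j) * r)"
  proof (rule sum_mono)
    fix j assume "j \<in> {..<n}"
    then have "norm (v $ j) \<le> w j * r" using le[of j] w[of j] by (simp add: field_simps)
    then show "norm (A $$ (i, j)) * norm (v $ j) \<le> (norm (A $$ (i, j)) * w j) * r"
      by (simp add: mult.assoc mult_left_mono)
  qed
  also have "\<dots> = (\<Sum>j<n. norm (A $$ (i, j)) * w j) * r" by (simp add: sum_distrib_right)
  also have "\<dots> \<le> w i * r" using row[OF i(1)] r by (intro mult_right_mono) auto
  also have "\<dots> = norm (v $ i)" using w[of i] i by simp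
  finally have "norm e * norm (v $ i) \<le> norm (v $ i)" .
  moreover have "norm (v $ i) > 0" using r w[of i] i by (simp add: zero_less_divide_iff)
  ultimately show ?thesis by (simp add: mult_le_cancel_right1)
qed

text \<open>
  Sum the logarithm series over the eigenvalues of the complexified matrix. The coefficients are traces
  of real matrices, so the sum of the principal logarithms is real; its exponential is the determinant,
  which is therefore positive. The term for \<open>k = 0\<close> vanishes because division by zero yields zero.
\<close>

lemma ln_det_series:
  fixes A :: "real mat" and w :: "nat \<Rightarrow> real" and z :: real
  assumes A: "A \<in> carrier_mat n n" and w: "\<And>i. w i > 0"
    and row: "\<And>i. i < n \<Longrightarrow> (\<Sum>j<n. \<bar>A $$ (i, j)\<bar> * w j) \<le> w i"
    and z: "\<bar>z\<bar> < 1"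
  shows "(\<lambda>k. z ^ k / real k * (\<Sum>i<n. (A ^\<^sub>m k) $$ (i, i))) sums - ln (Determinant.det (1\<^sub>m n - z \<cdot>\<^sub>m A))"
proof -
  let ?C = "map_mat complex_of_real A"
  have C: "?C \<in> carrier_mat n n" using A by simp
  obtain e where e: "\<And>i. i < n \<Longrightarrow> eigenvalue ?C (e i)"
    "\<And>k. (\<Sum>i<n. (?C ^\<^sub>m k) $$ (i, i)) = (\<Sum>i<n. e i ^ k)"
    "\<And>z. Determinant.det (1\<^sub>m n - z \<cdot>\<^sub>m ?C) = (\<Prod>i<n. 1 - z * e i)"
    using complex_mat_eigenvalue_list[OF C] by blast
  have e1: "norm (e i) \<le> 1" if "i < n" for i
    by (rule eigenvalue_norm_le_1[OF C w _ e(1)[OF that]]) (use row A in auto)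
  have lt: "norm (of_real z * e i) < 1" if "i < n" for i
  proof -
    have "norm (of_real z * e i) \<le> \<bar>z\<bar> * 1" unfolding norm_mult using e1[OF that] by (intro mult_mono) auto
    then show ?thesis using z by simp
  qed
  define L where "L = (\<Sum>i<n. Ln (1 - of_real z * e i))"
  have "(\<lambda>k. \<Sum>i<n. - ((of_real z * e i) ^ k) / of_nat k) sums L"
    unfolding L_def
  proof (rule sums_sum)
    fix i assume "i \<in> {..<n}"
    then show "(\<lambda>k. - ((of_real z * e i) ^ k) / of_nat k) sums Ln (1 - of_real z * e i)"
      using Ln_series'[of "- (of_real z * e i)"] lt[of i] by simp
  qed
  moreover have "(\<Sum>i<n. - ((of_real z * e i) ^ k) / of_nat k)
      = of_real (- (z ^ k / real k * (\<Sum>i<n. (A ^\<^sub>m k) $$ (i, i))))" for k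
  proof -
    have "(\<Sum>i<n. - ((of_real z * e i) ^ k) / of_nat k) = - (of_real z ^ k / of_nat k * (\<Sum>i<n. e i ^ k))"
      by (simp add: power_mult_distrib sum_distrib_left sum_negf sum_divide_distrib)
    also have "(\<Sum>i<n. e i ^ k) = (\<Sum>i<n. (map_mat complex_of_real (A ^\<^sub>m k)) $$ (i, i))"
      by (simp only: e(2)[symmetric] of_real_hom.mat_hom_pow[OF A])
    also have "\<dots> = of_real (\<Sum>i<n. (A ^\<^sub>m k) $$ (i, i))" using A by simp
    finally show ?thesis by simp
  qed
  ultimately have sL: "(\<lambda>k. of_real (- (z ^ k / real k * (\<Sum>i<n. (A ^\<^sub>m k) $$ (i, i)))) :: complex) sums L"
    by simp
  \<comment> \<open>The terms are real, so the imaginary part of the sum vanishes.\<close>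
  from sums_Re[OF this] have sR: "(\<lambda>k. - (z ^ k / real k * (\<Sum>i<n. (A ^\<^sub>m k) $$ (i, i)))) sums Re L" by simp
  from sums_Im[OF sL] have "(\<lambda>k. 0) sums Im L" by simp
  then have "Im L = 0" by (metis sums_0 sums_unique2)
  then have L: "L = of_real (Re L)" by (simp add: complex_eq_iff)
  have "of_real (exp (Re L)) = exp L" by (subst L) (simp add: exp_of_real)
  also have "\<dots> = (\<Prod>i<n. exp (Ln (1 - of_real z * e i)))" unfolding L_def by (rule exp_sum) simp
  also have "\<dots> = (\<Prod>i<n. 1 - of_real z * e i)"
  proof (rule prod.cong[OF refl])
    fix i assume "i \<in> {..<n}"
    then have "1 - of_real z * e i \<noteq> 0" using lt[of i] by auto
    then show "exp (Ln (1 - of_real z * e i)) = 1 - of_real z * e i" by simp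
  qed
  also have "\<dots> = Determinant.det (1\<^sub>m n - of_real z \<cdot>\<^sub>m ?C)" by (simp add: e(3))
  also have "1\<^sub>m n - of_real z \<cdot>\<^sub>m ?C = map_mat complex_of_real (1\<^sub>m n - z \<cdot>\<^sub>m A)"
    using A by (intro eq_matI) auto
  also have "Determinant.det \<dots> = of_real (Determinant.det (1\<^sub>m n - z \<cdot>\<^sub>m A))"
    by (rule of_real_hom.hom_det)
  finally have "Determinant.det (1\<^sub>m n - z \<cdot>\<^sub>m A) = exp (Re L)" by (simp only: of_real_eq_iff)
  then have "ln (Determinant.det (1\<^sub>m n - z \<cdot>\<^sub>m A)) = Re L" by simp
  with sums_minus[OF sR] show ?thesis by simp
qed

section \<open>The power series of the squared arcsine\<close>

text \<open>
  Let \<open>f y\<close> be the power series with coefficients \<open>a k\<close>. The recurrence amounts to the differential equation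
  \<open>(1 - y) * (f y + 2 * y * f' y) = 1 + y * f y\<close>, which says that \<open>sqrt (1 - t^2) * t * f (t^2)\<close> has
  the derivative of \<open>arcsin t\<close>. Hence \<open>2 * t * f (t^2)\<close>, the derivative of the left-hand side, is the
  derivative of the squared arcsine.
\<close>

lemma arcsin_squared_series:
  fixes a :: "nat \<Rightarrow> real" and x :: real
  assumes a0: "a 0 = 1" and aS: "\<And>k. a (Suc k) = real (2 * k + 2) / real (2 * k + 3) * a k"
    and x: "\<bar>x\<bar> < 1"
  shows "(\<lambda>k. a k / real (Suc k) * x\<^sup>2 ^ Suc k) sums (arcsin x)\<^sup>2"
proof -
  have a: "0 \<le> a k \<and> a k \<le> 1" for k
  proof (induction k)
    case (Suc k)
    have "real (2 * k + 2) / real (2 * k + 3) \<le> 1" by simp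
    then show ?case unfolding aS using Suc by (intro conjI mult_le_one) auto
  qed (simp add: a0)
  have sum1: "summable (\<lambda>k. real (Suc k) * (c k * y ^ k))" if y: "\<bar>y\<bar> < 1" and c: "\<And>k. \<bar>c k\<bar> \<le> 1" for y and c :: "nat \<Rightarrow> real"
  proof (rule summable_comparison_test)
    show "summable (\<lambda>k. real (Suc k) * \<bar>y\<bar> ^ k)"
      using geometric_deriv_sums[of "\<bar>y\<bar>"] y by (auto simp: sums_iff)
    have "norm (real (Suc k) * (c k * y ^ k)) \<le> real (Suc k) * \<bar>y\<bar> ^ k" for k
      using c[of k] by (simp add: abs_mult power_abs mult_left_le_one_le del: of_nat_Suc)
    then show "\<exists>K. \<forall>k\<ge>K. norm (real (Suc k) * (c k * y ^ k)) \<le> real (Suc k) * \<bar>y\<bar> ^ k" by blast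
  qed
  have sum0: "summable (\<lambda>k. c k * y ^ k)" if y: "\<bar>y\<bar> < 1" and c: "\<And>k. \<bar>c k\<bar> \<le> 1" for y and c :: "nat \<Rightarrow> real"
  proof (rule summable_comparison_test)
    show "summable (\<lambda>k. \<bar>y\<bar> ^ k)" using y by (simp add: summable_geometric)
    show "\<exists>K. \<forall>k\<ge>K. norm (c k * y ^ k) \<le> \<bar>y\<bar> ^ k"
      using c by (auto simp: abs_mult power_abs mult_left_le_one_le)
  qed
  have abs_a: "\<bar>a k\<bar> \<le> 1" for k using a[of k] by auto
  define f where "f y = (\<Sum>k. a k * y ^ k)" for y
  define f' where "f' y = (\<Sum>k. real (Suc k) * (a (Suc k) * y ^ k))" for y
  define F where "F y = (\<Sum>k. a k / real (Suc k) * y ^ Suc k)" for y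
  have F: "(F has_real_derivative f y) (at y)" if "\<bar>y\<bar> < 1" for y
  proof -
    have "((\<lambda>y. \<Sum>k. a k / real (Suc k) * y ^ Suc k) has_real_derivative
        (\<Sum>k. a k / real (Suc k) * real (Suc k) * y ^ k)) (at y)"
      by (rule DERIV_power_series'[of 1]) (use that sum0[OF _ abs_a] in \<open>auto simp: abs_less_iff\<close>)
    then show ?thesis by (simp add: F_def[abs_def] f_def del: of_nat_Suc)
  qed
  have f: "(f has_real_derivative f' y) (at y)" if "\<bar>y\<bar> < 1" for y
  proof -
    have d: "((\<lambda>y. \<Sum>k. a (Suc k) * y ^ Suc k) has_real_derivative
        (\<Sum>k. a (Suc k) * real (Suc k) * y ^ k)) (at y)"
      by (rule DERIV_power_series'[of 1])
         (use that sum1[of _ "\<lambda>k. a (Suc k)"] abs_a in \<open>auto simp: abs_less_iff mult_ac simp del: of_nat_Suc\<close>)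
    have "((\<lambda>y. a 0 + (\<Sum>k. a (Suc k) * y ^ Suc k)) has_real_derivative f' y) (at y)"
      using DERIV_add[OF DERIV_const[of "a 0"] d] by (simp add: f'_def mult_ac del: of_nat_Suc)
    moreover have "a 0 + (\<Sum>k. a (Suc k) * u ^ Suc k) = f u" if "u \<in> {-1<..<1}" for u
      using suminf_split_head[OF sum0[of u a]] abs_a that by (simp add: f_def abs_less_iff)
    ultimately show ?thesis
      using that by - (erule has_field_derivative_transform_within_open[where S = "{-1<..<1}"],
        auto simp: abs_less_iff)
  qed
  have ode: "(1 - y) * (f y + 2 * y * f' y) = 1 + y * f y" if y: "\<bar>y\<bar> < 1" for y
  proof -
    define s where "s = (\<Sum>k. real (2 * k + 1) * a k * y ^ k)"
    have s0: "summable (\<lambda>k. a k * y ^ k)" by (intro sum0 y abs_a)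
    have s1: "summable (\<lambda>k. real (2 * k) * a k * y ^ k)"
    proof -
      have "summable (\<lambda>k. 2 * (real (Suc k) * (a k * y ^ k) - a k * y ^ k))"
        by (intro summable_diff summable_mult sum1 s0 y abs_a)
      then show ?thesis by (simp add: algebra_simps)
    qed
    have sS: "summable (\<lambda>k. real (2 * k + 1) * a k * y ^ k)"
      using summable_add[OF s0 s1] by (simp add: algebra_simps)
    have "s = f y + 2 * y * f' y"
    proof -
      have "2 * y * f' y = (\<Sum>k. 2 * y * (real (Suc k) * (a (Suc k) * y ^ k)))"
        unfolding f'_def by (intro suminf_mult[symmetric] sum1 y abs_a)
      also have "\<dots> = (\<Sum>k. real (2 * Suc k) * a (Suc k) * y ^ Suc k)"
        by (simp add: mult_ac)
      also have "\<dots> = (\<Sum>k. real (2 * k) * a k * y ^ k)"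
        using suminf_split_head[OF s1] by simp
      finally show ?thesis
        using suminf_add[OF s0 s1] by (simp add: s_def f_def algebra_simps)
    qed
    moreover have "s = 1 + y * s + y * f y"
    proof -
      have "s = a 0 + (\<Sum>k. real (2 * Suc k + 1) * a (Suc k) * y ^ Suc k)"
        using suminf_split_head[OF sS] by (simp add: s_def)
      also have "(\<lambda>k. real (2 * Suc k + 1) * a (Suc k) * y ^ Suc k) = (\<lambda>k. y * (real (2 * k + 1) * a k * y ^ k + a k * y ^ k))"
      proof
        fix k
        have "real (2 * Suc k + 1) * a (Suc k) = real (2 * k + 2) * a k"
          unfolding aS by (simp add: field_simps)
        then show "real (2 * Suc k + 1) * a (Suc k) * y ^ Suc k = y * (real (2 * k + 1) * a k * y ^ k + a k * y ^ k)"
          by (simp add: algebra_simps)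
      qed
      also have "(\<Sum>k. y * (real (2 * k + 1) * a k * y ^ k + a k * y ^ k)) = y * (s + f y)"
        unfolding s_def f_def using sS s0 by (simp only: suminf_add suminf_mult summable_add)
      finally show ?thesis by (simp add: a0 algebra_simps)
    qed
    then have "(1 - y) * s = 1 + y * f y" by (simp add: left_diff_distrib)
    ultimately show ?thesis by simp
  qed
  have sq: "\<bar>t\<^sup>2\<bar> < 1" "0 < 1 - t\<^sup>2" if "\<bar>t\<bar> < 1" for t :: real
    using that by (simp_all add: abs_square_less_1)
  have g: "sqrt (1 - t\<^sup>2) * (t * f (t\<^sup>2)) = arcsin t" if t: "\<bar>t\<bar> < 1" for t
  proof -
    let ?h = "\<lambda>t. sqrt (1 - t\<^sup>2) * (t * f (t\<^sup>2)) - arcsin t"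
    have "(?h has_real_derivative 0) (at u)" if u: "\<bar>u\<bar> < 1" for u
    proof -
      define q where "q = sqrt (1 - u\<^sup>2)"
      have q: "q > 0" "q * q = 1 - u\<^sup>2" using sq[OF u] by (simp_all add: q_def)
      have d1: "((\<lambda>t. sqrt (1 - t\<^sup>2)) has_real_derivative - u / q) (at u)"
        using sq(2)[OF u] by (auto intro!: derivative_eq_intros simp: q_def field_simps)
      have d2: "((\<lambda>t. t * f (t\<^sup>2)) has_real_derivative f (u\<^sup>2) + 2 * u\<^sup>2 * f' (u\<^sup>2)) (at u)"
      proof -
        have "((\<lambda>t. f (t\<^sup>2)) has_real_derivative f' (u\<^sup>2) * (2 * u)) (at u)"
          by (rule DERIV_chain2[where g = "\<lambda>t. t\<^sup>2", OF f[OF sq(1)[OF u]]]) (auto intro!: derivative_eq_intros)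
        from DERIV_mult[OF DERIV_ident this] show ?thesis
          by (simp add: power2_eq_square mult_ac add.commute)
      qed
      have d3: "(arcsin has_real_derivative 1 / q) (at u)"
        using DERIV_arcsin[of u] u by (simp add: q_def inverse_eq_divide abs_less_iff)
      have "q * q * (f (u\<^sup>2) + 2 * u\<^sup>2 * f' (u\<^sup>2)) = 1 + u\<^sup>2 * f (u\<^sup>2)"
        using ode[OF sq(1)[OF u]] by (simp add: q(2))
      then have "- u / q * (u * f (u\<^sup>2)) + (f (u\<^sup>2) + 2 * u\<^sup>2 * f' (u\<^sup>2)) * q - 1 / q = 0"
        using q(1) by (simp add: field_simps power2_eq_square)
      then show ?thesis
        using DERIV_diff[OF DERIV_mult[OF d1 d2] d3] by (simp add: q_def)
    qed
    then have "?h t = ?h 0"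
      using t by (intro DERIV_isconst3[of "-1" 1 t 0 ?h]) (auto simp: abs_less_iff)
    then show ?thesis by simp
  qed
  have "F (x\<^sup>2) - (arcsin x)\<^sup>2 = F (0\<^sup>2) - (arcsin 0)\<^sup>2"
  proof (rule DERIV_isconst3[of "-1" 1 x 0 "\<lambda>t. F (t\<^sup>2) - (arcsin t)\<^sup>2"])
    fix u :: real assume "u \<in> {-1<..<1}"
    then have u: "\<bar>u\<bar> < 1" by (auto simp: abs_less_iff)
    define q where "q = sqrt (1 - u\<^sup>2)"
    have q: "q > 0" using sq[OF u] by (simp add: q_def)
    have d1: "((\<lambda>t. F (t\<^sup>2)) has_real_derivative f (u\<^sup>2) * (2 * u)) (at u)"
      by (rule DERIV_chain2[where g = "\<lambda>t. t\<^sup>2", OF F[OF sq(1)[OF u]]]) (auto intro!: derivative_eq_intros)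
    have d3: "(arcsin has_real_derivative 1 / q) (at u)"
      using DERIV_arcsin[of u] u by (simp add: q_def inverse_eq_divide abs_less_iff)
    have d2: "((\<lambda>t. (arcsin t)\<^sup>2) has_real_derivative 2 * (1 / q * arcsin u)) (at u)"
      using DERIV_power[OF d3, of 2] by (simp add: mult_ac)
    have "f (u\<^sup>2) * (2 * u) - 2 * (1 / q * arcsin u) = 0"
      using q g[OF u] by (simp add: q_def[symmetric] field_simps)
    then show "((\<lambda>t. F (t\<^sup>2) - (arcsin t)\<^sup>2) has_real_derivative 0) (at u)"
      using DERIV_diff[OF d1 d2] by simp
  qed (use x in \<open>auto simp: abs_less_iff\<close>)
  then have "F (x\<^sup>2) = (arcsin x)\<^sup>2" by (simp add: F_def)
  moreover have "summable (\<lambda>k. a k / real (Suc k) * x\<^sup>2 ^ Suc k)"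
  proof -
    have "\<bar>a k / real (Suc k)\<bar> \<le> 1" for k
      using a[of k] by (simp add: divide_le_eq)
    then have "summable (\<lambda>k. a k / real (Suc k) * x\<^sup>2 ^ k)" by (rule sum0[OF sq(1)[OF x]])
    from summable_mult2[OF this, of "x\<^sup>2"] show ?thesis
      by (simp add: mult_ac del: of_nat_Suc)
  qed
  ultimately show ?thesis by (simp add: F_def sums_iff)
qed

lemma sech_transform_even_at_0: "sech_transform (2 * Suc k + 2) 0 / (2 * pi) = real (2 * k + 2) / real (2 * k + 3) * (sech_transform (2 * k + 2) 0 / (2 * pi))"
  using sech_transform_recurrence_at_0[of "2 * k + 2"] by simp

lemma arcsin_squared_sech_transform_series:
  assumes "\<bar>x\<bar> < 1"
  shows "(\<lambda>k. (x\<^sup>2) ^ Suc k / real (Suc k) * (sech_transform (2 * k + 2) 0 / (2 * pi))) sums ((arcsin x)\<^sup>2 / pi\<^sup>2)"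
proof -
  define a where "a k = pi\<^sup>2 * (sech_transform (2 * k + 2) 0 / (2 * pi))" for k
  have "a 0 = 1" by (simp add: a_def sech_transform_2_at_0[simplified] power2_eq_square numeral_2_eq_2[symmetric])
  moreover have "a (Suc k) = real (2 * k + 2) / real (2 * k + 3) * a k" for k
    unfolding a_def sech_transform_even_at_0 by (simp only: mult_ac)
  ultimately have "(\<lambda>k. a k / real (Suc k) * x\<^sup>2 ^ Suc k) sums (arcsin x)\<^sup>2"
    using assms by (intro arcsin_squared_series)
  from sums_divide[OF this, of "pi\<^sup>2"] show ?thesis
    by (simp add: a_def mult_ac del: of_nat_Suc)
qed

section \<open>The determinant of the truncated squared Hilbert matrix\<close>

definition hilbert_section :: "nat \<Rightarrow> real mat" where
  "hilbert_section N = finite_section N (ell2_proj N \<circ> hilbert_op \<circ> hilbert_op \<circ> ell2_proj N)"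

lemma hilbert_section_carrier: "hilbert_section N \<in> carrier_mat N N"
  by (simp add: hilbert_section_def finite_section_def)

lemma hilbert_section_index:
  assumes "n < N" "m < N"
  shows "hilbert_section N $$ (n, m) = (\<Sum>k. hilbert_matrix n k * hilbert_matrix k m)"
  unfolding hilbert_section_def by (rule hilbert_section_entry[OF assms])

lemma hilbert_matrix_commute: "hilbert_matrix n m = hilbert_matrix m n"
  by (simp add: hilbert_matrix_def add.commute)

lemma summable_hilbert_square: "summable (\<lambda>i. hilbert_matrix n i * hilbert_matrix i m)"
  using hilbert_op_summable[OF hilbert_row_ell2[of m], of n] by (simp add: hilbert_matrix_commute)

lemma hilbert_section_sum:
  assumes "n < N"
  shows "(\<Sum>l<N. hilbert_section N $$ (n, l) * v l) = (\<Sum>i. hilbert_matrix n i * (\<Sum>l<N. hilbert_matrix i l * v l))"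
    and "summable (\<lambda>i. hilbert_matrix n i * (\<Sum>l<N. hilbert_matrix i l * v l))"
proof -
  have e: "(\<lambda>i. hilbert_matrix n i * (\<Sum>l<N. hilbert_matrix i l * v l))
      = (\<lambda>i. \<Sum>l<N. hilbert_matrix n i * hilbert_matrix i l * v l)"
    by (simp add: sum_distrib_left mult.assoc)
  show "summable (\<lambda>i. hilbert_matrix n i * (\<Sum>l<N. hilbert_matrix i l * v l))"
    unfolding e by (intro summable_sum summable_mult2 summable_hilbert_square)
  have "(\<Sum>l<N. hilbert_section N $$ (n, l) * v l) = (\<Sum>l<N. \<Sum>i. hilbert_matrix n i * hilbert_matrix i l * v l)"
    using assms by (intro sum.cong refl) (simp add: hilbert_section_index suminf_mult2[OF summable_hilbert_square])
  also have "\<dots> = (\<Sum>i. \<Sum>l<N. hilbert_matrix n i * hilbert_matrix i l * v l)"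
    by (intro suminf_sum[symmetric] summable_mult2 summable_hilbert_square)
  finally show "(\<Sum>l<N. hilbert_section N $$ (n, l) * v l) = (\<Sum>i. hilbert_matrix n i * (\<Sum>l<N. hilbert_matrix i l * v l))"
    by (simp only: e)
qed

lemma pow_mat_Suc_left:
  fixes A :: "'a :: semiring_1 mat"
  assumes A: "A \<in> carrier_mat n n" shows "A ^\<^sub>m Suc k = A * A ^\<^sub>m k"
proof (induction k)
  case (Suc k)
  have "A ^\<^sub>m Suc (Suc k) = (A * A ^\<^sub>m k) * A" by (simp flip: Suc)
  also have "\<dots> = A * A ^\<^sub>m Suc k" using A by (simp add: assoc_mult_mat[of _ n n _ n _ n])
  finally show ?case .
qed (use A in simp)

lemma hilbert_section_pow:
  assumes "n < N" "m < N"
  shows "(hilbert_section N ^\<^sub>m Suc k) $$ (n, m) = section_power N k n m"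
  using assms(1)
proof (induction k arbitrary: n)
  case 0
  then show ?case using assms(2) hilbert_section_carrier[of N]
    by (simp add: hilbert_section_index section_power_def)
next
  case (Suc k)
  let ?A = "hilbert_section N"
  have A: "?A \<in> carrier_mat N N" "?A ^\<^sub>m Suc k \<in> carrier_mat N N"
    using hilbert_section_carrier[of N] by (auto simp del: pow_mat.simps)
  have "(?A ^\<^sub>m Suc (Suc k)) $$ (n, m) = (?A * ?A ^\<^sub>m Suc k) $$ (n, m)"
    by (simp only: pow_mat_Suc_left[OF A(1), of "Suc k"])
  also have "\<dots> = (\<Sum>l<N. ?A $$ (n, l) * (?A ^\<^sub>m Suc k) $$ (l, m))"
    using A Suc.prems assms(2) by (simp add: scalar_prod_def lessThan_atLeast0 del: pow_mat.simps)
  also have "\<dots> = (\<Sum>l<N. ?A $$ (n, l) * section_power N k l m)"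
    using Suc.IH by (intro sum.cong) auto
  also have "\<dots> = section_power N (Suc k) n m"
    using hilbert_section_sum(1)[OF Suc.prems, of "\<lambda>l. section_power N k l m"]
    by (simp add: section_power_def)
  finally show ?case .
qed

text \<open>
  Two applications of \<open>hilbert_matrix_weight_sum\<close>; truncation only removes nonnegative terms.
\<close>

lemma hilbert_section_row_sum:
  assumes "n < N"
  shows "(\<Sum>l<N. \<bar>hilbert_section N $$ (n, l)\<bar> * weight l) \<le> weight n"
proof -
  have "0 \<le> hilbert_section N $$ (n, l)" if "l < N" for l
    using assms that summable_hilbert_square by (simp add: hilbert_section_index suminf_nonneg)
  then have "(\<Sum>l<N. \<bar>hilbert_section N $$ (n, l)\<bar> * weight l) = (\<Sum>l<N. hilbert_section N $$ (n, l) * weight l)"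
    by (intro sum.cong) auto
  also have "\<dots> = (\<Sum>i. hilbert_matrix n i * (\<Sum>l<N. hilbert_matrix i l * weight l))"
    by (rule hilbert_section_sum[OF assms])
  also have "\<dots> \<le> (\<Sum>i. hilbert_matrix n i * weight i)"
  proof (intro suminf_le hilbert_section_sum[OF assms] hilbert_matrix_weight_sum mult_left_mono)
    fix i
    have "(\<Sum>l<N. hilbert_matrix i l * weight l) \<le> (\<Sum>l. hilbert_matrix i l * weight l)"
      by (intro sum_le_suminf hilbert_matrix_weight_sum) auto
    then show "(\<Sum>l<N. hilbert_matrix i l * weight l) \<le> weight i"
      using hilbert_matrix_weight_sum(2)[of i] by linarith
  qed simp
  also have "\<dots> \<le> weight n" by (rule hilbert_matrix_weight_sum)
  finally show ?thesis .
qed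

lemma ln_det_hilbert_section:
  assumes "\<bar>z\<bar> < 1"
  shows "(\<lambda>k. z ^ Suc k / real (Suc k) * (\<Sum>n<N. section_power N k n n))
    sums - ln (Determinant.det (1\<^sub>m N - z \<cdot>\<^sub>m hilbert_section N))"
proof -
  have "(\<lambda>k. z ^ k / real k * (\<Sum>i<N. (hilbert_section N ^\<^sub>m k) $$ (i, i)))
      sums - ln (Determinant.det (1\<^sub>m N - z \<cdot>\<^sub>m hilbert_section N))"
    by (rule ln_det_series[OF hilbert_section_carrier weight_pos hilbert_section_row_sum assms])
  then have "(\<lambda>k. z ^ Suc k / real (Suc k) * (\<Sum>i<N. (hilbert_section N ^\<^sub>m Suc k) $$ (i, i)))
      sums - ln (Determinant.det (1\<^sub>m N - z \<cdot>\<^sub>m hilbert_section N))"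
    by (subst sums_Suc_iff) simp
  then show ?thesis by (simp add: hilbert_section_pow del: pow_mat.simps of_nat_Suc)
qed

theorem corollary1p5:
  fixes \<beta> :: real
  assumes "0 \<le> \<beta>" and "\<beta> < 1"
  shows "(\<lambda>N::nat.
            ln (Determinant.det (1\<^sub>m N - \<beta>\<^sup>2 \<cdot>\<^sub>m
                  finite_section N (ell2_proj N \<circ> hilbert_op \<circ> hilbert_op \<circ> ell2_proj N)))
            - (- (1 / pi\<^sup>2) * (arcsin \<beta>)\<^sup>2 * ln (real N)))
         \<in> o(\<lambda>N. ln (real N))"
proof -
  let ?z = "\<beta>\<^sup>2"
  have \<beta>: "\<bar>\<beta>\<bar> < 1" and z: "\<bar>?z\<bar> < 1" "0 \<le> ?z" "?z < 1"
    using assms by (simp_all add: abs_square_less_1 power_less_one_iff)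
  define D where "D N = ln (Determinant.det (1\<^sub>m N - ?z \<cdot>\<^sub>m hilbert_section N))" for N
  define t where "t k N = ?z ^ Suc k / real (Suc k) * ((\<Sum>n<N. section_power N k n n) / ln (real N))" for k N
  have D: "- D N / ln (real N) = (\<Sum>k. t k N)" for N
    using sums_divide[OF ln_det_hilbert_section[OF z(1), of N], of "ln (real N)"]
    by (simp add: t_def D_def sums_iff)
  have "(\<lambda>N. \<Sum>k. t k N) \<longlonglongrightarrow> (\<Sum>k. ?z ^ Suc k / real (Suc k) * (sech_transform (2 * k + 2) 0 / (2 * pi)))"
  proof (rule tannerys_theorem[THEN conjunct2, THEN conjunct2])
    show "(\<lambda>N. t k N) \<longlonglongrightarrow> ?z ^ Suc k / real (Suc k) * (sech_transform (2 * k + 2) 0 / (2 * pi))" for k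
      unfolding t_def by (intro tendsto_mult tendsto_const section_power_trace_asymp)
    show "summable (\<lambda>k. ?z ^ k)" using z by (simp add: summable_geometric)
    have "eventually (\<lambda>N. (\<Sum>n<N. 1 / node n) / ln (real N) < 2) sequentially"
      using inverse_node_sum_asymp by (rule order_tendstoD) simp
    moreover have "eventually (\<lambda>N::nat. ln (real N) > 0) sequentially" by real_asymp
    ultimately have "eventually (\<lambda>N. \<forall>k. norm (t k N) \<le> ?z ^ k) sequentially"
    proof eventually_elim
      case (elim N)
      show ?case
      proof
        fix k
        have nn: "0 \<le> (\<Sum>n<N. section_power N k n n)" using section_bounds(2) by (intro sum_nonneg) auto
        have "(\<Sum>n<N. section_power N k n n) \<le> (\<Sum>n<N. weight n * weight n / (2 * pi))"
          using section_bounds(2) by (intro sum_mono) auto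
        also have "\<dots> = 1 / (2 * pi) * (\<Sum>n<N. 1 / node n)"
          by (simp add: weight_def sum_divide_distrib)
        also have "\<dots> \<le> 1 / 2 * (\<Sum>n<N. 1 / node n)"
          using pi_ge_two by (intro mult_right_mono sum_nonneg) auto
        finally have "(\<Sum>n<N. section_power N k n n) / ln (real N) \<le> 1 / 2 * (\<Sum>n<N. 1 / node n) / ln (real N)"
          using elim by (intro divide_right_mono) auto
        also have "\<dots> \<le> 1" using elim by (simp add: field_simps)
        finally have "t k N \<le> ?z ^ Suc k / real (Suc k) * 1"
          unfolding t_def by (intro mult_left_mono) auto
        also have "\<dots> \<le> ?z ^ k / 1"
          using z by (simp only: mult_1_right) (intro frac_le power_decreasing; simp)
        finally have "t k N \<le> ?z ^ k" by simp
        moreover have "0 \<le> t k N" using nn elim by (simp add: t_def)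
        ultimately show "norm (t k N) \<le> ?z ^ k" by simp
      qed
    qed
    then show "eventually (\<lambda>(k, N). norm (t k N) \<le> ?z ^ k) (at_top \<times>\<^sub>F sequentially)"
      unfolding eventually_prod_filter
      by (intro exI[of _ "\<lambda>_. True"] exI[of _ "\<lambda>N. \<forall>k. norm (t k N) \<le> ?z ^ k"]) auto
  qed simp
  also have "(\<Sum>k. ?z ^ Suc k / real (Suc k) * (sech_transform (2 * k + 2) 0 / (2 * pi))) = (arcsin \<beta>)\<^sup>2 / pi\<^sup>2"
    using arcsin_squared_sech_transform_series[OF \<beta>] by (simp add: sums_iff)
  finally have "(\<lambda>N. - D N / ln (real N)) \<longlonglongrightarrow> (arcsin \<beta>)\<^sup>2 / pi\<^sup>2" by (simp only: D)
  from tendsto_diff[OF tendsto_const[of "(arcsin \<beta>)\<^sup>2 / pi\<^sup>2"] this]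
  have lim: "(\<lambda>N. (arcsin \<beta>)\<^sup>2 / pi\<^sup>2 + D N / ln (real N)) \<longlonglongrightarrow> 0" by simp
  have "eventually (\<lambda>N::nat. ln (real N) > 0) sequentially" by real_asymp
  then have nz: "eventually (\<lambda>N::nat. ln (real N) \<noteq> 0) sequentially"
    by (rule eventually_mono) simp
  have "(\<lambda>N. D N - (- (1 / pi\<^sup>2) * (arcsin \<beta>)\<^sup>2 * ln (real N))) \<in> o(\<lambda>N. ln (real N))"
  proof (rule smalloI_tendsto[OF _ nz])
    show "(\<lambda>N. (D N - (- (1 / pi\<^sup>2) * (arcsin \<beta>)\<^sup>2 * ln (real N))) / ln (real N)) \<longlonglongrightarrow> 0"
      by (rule Lim_transform_eventually[OF lim]) (use nz in \<open>eventually_elim; simp add: field_simps\<close>)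
  qed
  then show ?thesis by (simp only: D_def hilbert_section_def)
qed

end
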